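(* Let $\mathcal{O}$ be a complete rank-$1$ valuation ring with nontrivial valuation and pseudo-uniformizer $\varpi$, and let $\mathfrak{X}=\mathrm{Spf}(R)$ be an affine admissible normal formal $\mathcal{O}$-scheme with ideal of definition $(\varpi)$ such that $\mathfrak{X}_{\mathrm{red}}$ is Noetherian. Then the maximal specialization map $$\mathrm{sp}_{\max,\mathfrak{X}}\colon|\mathfrak{X}_\eta|\to|\mathfrak{X}_{\mathrm{red}}|$$ is anticontinuous: inverse images of closed subsets are open, and inverse images of open subsets are closed.
   Context: $\mathfrak{X}_\eta=\mathrm{Spa}(R[1/\varpi],R)$ is the adic generic fiber of $\mathfrak{X}=\mathrm{Spf}(R)$, and $\mathfrak{X}_{\mathrm{red}}$ is the reduced special fiber, with underlying space $|\mathrm{Spec}(R/\varpi R)|$. The specialization map is $\mathrm{sp}_{\mathfrak X}(x)=\{\bar a\in R/\varpi R : |a(x)|<1\}$, where $a\in R$ is any lift of $\bar a$. Every point $x\in|\mathfrak{X}_\eta|$ has a unique maximal generalization $x_{\max}$, which is a rank-$1$ point. The maximal specialization map is $\mathrm{sp}_{\max,\mathfrak X}(x)=\mathrm{sp}_{\mathfrak X}(x_{\max})$. *)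

theory Defs
  imports
    "HOL-Algebra.QuotRing"
    "HOL-Algebra.Ring_Divisibility"
    "HOL-Algebra.Generated_Groups"
    "HOL-Analysis.Function_Topology"
    "HOL-Library.Poly_Mapping"
begin

text \<open>
  Rings are the record-based rings of HOL-Algebra; unless one asks for a domain, the zero ring
  is allowed.  Points of adic spaces and of formal schemes are handled through explicit sets
  and the library's abstract topologies.
\<close>

section \<open>Localisation\<close>

definition frac_rel :: "('a, 'm) ring_scheme \<Rightarrow> 'a set \<Rightarrow> (('a \<times> 'a) \<times> ('a \<times> 'a)) set" where
  "frac_rel R S = {((a, s), (b, t)). a \<in> carrier R \<and> b \<in> carrier R \<and> s \<in> S \<and> t \<in> S \<and>
     (\<exists>u\<in>S. u \<otimes>\<^bsub>R\<^esub> (t \<otimes>\<^bsub>R\<^esub> a) = u \<otimes>\<^bsub>R\<^esub> (s \<otimes>\<^bsub>R\<^esub> b))}"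

text \<open>
  The ring of fractions of \<open>R\<close> at a multiplicative subset \<open>S\<close> containing the unit.  Here, and for
  stalks below, an operation on equivalence classes is given as the saturation (image under the
  equivalence relation) of the set of all results obtained from representatives.
\<close>

definition localization :: "('a, 'm) ring_scheme \<Rightarrow> 'a set \<Rightarrow> ('a \<times> 'a) set ring" where
  "localization R S =
    \<lparr>carrier = (carrier R \<times> S) // frac_rel R S,
     mult = (\<lambda>X Y. frac_rel R S ``
       {(a \<otimes>\<^bsub>R\<^esub> b, s \<otimes>\<^bsub>R\<^esub> t) | a s b t. (a, s) \<in> X \<and> (b, t) \<in> Y}),
     one = frac_rel R S `` {(\<one>\<^bsub>R\<^esub>, \<one>\<^bsub>R\<^esub>)},
     zero = frac_rel R S `` {(\<zero>\<^bsub>R\<^esub>, \<one>\<^bsub>R\<^esub>)},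
     add = (\<lambda>X Y. frac_rel R S ``
       {((a \<otimes>\<^bsub>R\<^esub> t) \<oplus>\<^bsub>R\<^esub> (b \<otimes>\<^bsub>R\<^esub> s), s \<otimes>\<^bsub>R\<^esub> t) | a s b t. (a, s) \<in> X \<and> (b, t) \<in> Y})\<rparr>"

definition loc_map :: "('a, 'm) ring_scheme \<Rightarrow> 'a set \<Rightarrow> 'a \<Rightarrow> ('a \<times> 'a) set" where
  "loc_map R S a = frac_rel R S `` {(a, \<one>\<^bsub>R\<^esub>)}"

definition powers :: "('a, 'm) ring_scheme \<Rightarrow> 'a \<Rightarrow> 'a set" where
  "powers R f = {f [^]\<^bsub>R\<^esub> n | n :: nat. True}"

section \<open>Adic completion\<close>

text \<open>
  The \<open>a\<close>-adic completion of \<open>A\<close>, i.e. the inverse limit of the quotients by the powers of \<open>a\<close>.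
  Elements of the quotients are cosets, so a sequence of cosets is compatible precisely when it
  is decreasing for inclusion.
\<close>

definition adic_completion :: "('a, 'm) ring_scheme \<Rightarrow> 'a \<Rightarrow> (nat \<Rightarrow> 'a set) ring" where
  "adic_completion A a =
    (let Q = (\<lambda>n. A Quot (PIdl\<^bsub>A\<^esub> (a [^]\<^bsub>A\<^esub> n))) in
     \<lparr>carrier = {x. (\<forall>n. x n \<in> carrier (Q n)) \<and> (\<forall>n. x (Suc n) \<subseteq> x n)},
      mult = (\<lambda>x y n. x n \<otimes>\<^bsub>Q n\<^esub> y n),
      one = (\<lambda>n. \<one>\<^bsub>Q n\<^esub>),
      zero = (\<lambda>n. \<zero>\<^bsub>Q n\<^esub>),
      add = (\<lambda>x y n. x n \<oplus>\<^bsub>Q n\<^esub> y n)\<rparr>)"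

definition adically_complete :: "('a, 'm) ring_scheme \<Rightarrow> 'a \<Rightarrow> bool" where
  "adically_complete A a \<longleftrightarrow>
     bij_betw (\<lambda>r n. PIdl\<^bsub>A\<^esub> (a [^]\<^bsub>A\<^esub> n) +>\<^bsub>A\<^esub> r) (carrier A) (carrier (adic_completion A a))"

section \<open>Complete valuation rings of rank one\<close>

text \<open>
  The rank-one valuation is written multiplicatively and with real values.  The divisibility
  condition says that \<open>V\<close> is the whole unit ball of its fraction field.
\<close>

definition complete_rank_one_valuation_ring :: "('o, 'm) ring_scheme \<Rightarrow> ('o \<Rightarrow> real) \<Rightarrow> bool" where
  "complete_rank_one_valuation_ring V v \<longleftrightarrow>
     domain V \<and>
     (\<forall>x\<in>carrier V. 0 \<le> v x \<and> v x \<le> 1 \<and> (v x = 0 \<longleftrightarrow> x = \<zero>\<^bsub>V\<^esub>)) \<and>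
     (\<forall>x\<in>carrier V. \<forall>y\<in>carrier V. v (x \<otimes>\<^bsub>V\<^esub> y) = v x * v y) \<and>
     (\<forall>x\<in>carrier V. \<forall>y\<in>carrier V. v (x \<oplus>\<^bsub>V\<^esub> y) \<le> max (v x) (v y)) \<and>
     (\<forall>x\<in>carrier V. \<forall>y\<in>carrier V. v x \<le> v y \<longrightarrow> y divides\<^bsub>V\<^esub> x) \<and>
     (\<exists>x\<in>carrier V. 0 < v x \<and> v x < 1) \<and>
     (\<forall>s :: nat \<Rightarrow> 'o. range s \<subseteq> carrier V \<and>
        (\<forall>e>0. \<exists>N. \<forall>m\<ge>N. \<forall>n\<ge>N. v (s m \<ominus>\<^bsub>V\<^esub> s n) < e) \<longrightarrow>
        (\<exists>l\<in>carrier V. (\<lambda>n. v (s n \<ominus>\<^bsub>V\<^esub> l)) \<longlonglongrightarrow> 0))"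

definition pseudo_uniformizer :: "('o, 'm) ring_scheme \<Rightarrow> ('o \<Rightarrow> real) \<Rightarrow> 'o \<Rightarrow> bool" where
  "pseudo_uniformizer V v w \<longleftrightarrow> w \<in> carrier V \<and> 0 < v w \<and> v w < 1"

section \<open>Admissible algebras\<close>

text \<open>
  Restricted power series in the variables \<open>T\<^sub>0, \<dots>, T\<^bsub>n-1\<^esub>\<close>: families of coefficients indexed by
  the monomials in these variables, tending to zero.  A monomial is a finitely supported exponent
  function, and coefficients at monomials that involve other variables are zero.
\<close>

definition restricted_power_series ::
    "('o, 'm) ring_scheme \<Rightarrow> ('o \<Rightarrow> real) \<Rightarrow> nat \<Rightarrow> ((nat \<Rightarrow>\<^sub>0 nat) \<Rightarrow> 'o) ring" where
  "restricted_power_series V v n =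
    \<lparr>carrier = {c. range c \<subseteq> carrier V \<and>
        (\<forall>\<alpha>. \<not> Poly_Mapping.keys \<alpha> \<subseteq> {..<n} \<longrightarrow> c \<alpha> = \<zero>\<^bsub>V\<^esub>) \<and>
        (\<forall>e>0. finite {\<alpha>. v (c \<alpha>) \<ge> e})},
     mult = (\<lambda>c d \<gamma>. \<Oplus>\<^bsub>V\<^esub>p\<in>{p. fst p + snd p = \<gamma>}. c (fst p) \<otimes>\<^bsub>V\<^esub> d (snd p)),
     one = (\<lambda>\<alpha>. if \<alpha> = 0 then \<one>\<^bsub>V\<^esub> else \<zero>\<^bsub>V\<^esub>),
     zero = (\<lambda>\<alpha>. \<zero>\<^bsub>V\<^esub>),
     add = (\<lambda>c d \<alpha>. c \<alpha> \<oplus>\<^bsub>V\<^esub> d \<alpha>)\<rparr>"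

text \<open>
  \<open>R\<close> is a \<open>V\<close>-algebra through \<open>\<phi>\<close>.  Topologically of finite presentation means: a quotient of a
  ring of restricted power series by a finitely generated ideal.
\<close>

definition topologically_finitely_presented ::
    "('o, 'm) ring_scheme \<Rightarrow> ('o \<Rightarrow> real) \<Rightarrow> ('r, 'k) ring_scheme \<Rightarrow> ('o \<Rightarrow> 'r) \<Rightarrow> bool" where
  "topologically_finitely_presented V v R \<phi> \<longleftrightarrow>
     (\<exists>n h. let P = restricted_power_series V v n in
        h \<in> ring_hom P R \<and>
        h ` carrier P = carrier R \<and>
        (\<forall>a\<in>carrier V. h (\<lambda>\<alpha>. if \<alpha> = 0 then a else \<zero>\<^bsub>V\<^esub>) = \<phi> a) \<and>
        (\<exists>F. finite F \<and> F \<subseteq> carrier P \<and> a_kernel P R h = Idl\<^bsub>P\<^esub> F))"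

text \<open>
  The rings \<open>R\<close> for which \<open>Spf R\<close>, with ideal of definition generated by (the image of) \<open>w\<close>, is an
  admissible formal \<open>V\<close>-scheme.
\<close>

definition admissible_algebra ::
    "('o, 'm) ring_scheme \<Rightarrow> ('o \<Rightarrow> real) \<Rightarrow> 'o \<Rightarrow> ('r, 'k) ring_scheme \<Rightarrow> ('o \<Rightarrow> 'r) \<Rightarrow> bool" where
  "admissible_algebra V v w R \<phi> \<longleftrightarrow>
     cring R \<and> \<phi> \<in> ring_hom V R \<and>
     adically_complete R (\<phi> w) \<and>
     topologically_finitely_presented V v R \<phi> \<and>
     (\<forall>r\<in>carrier R. \<phi> w \<otimes>\<^bsub>R\<^esub> r = \<zero>\<^bsub>R\<^esub> \<longrightarrow> r = \<zero>\<^bsub>R\<^esub>)"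

section \<open>Stalks of an affine formal scheme and normality\<close>

text \<open>
  Let \<open>w\<close> generate an ideal of definition of \<open>R\<close>.  The ring of sections of the structure sheaf of
  \<open>Spf R\<close> on the basic open subset \<open>D(f)\<close> is the completion of \<open>R[1/f]\<close>.  We localise at the
  saturation of the powers of \<open>f\<close> (this gives the same ring), since saturations increase when \<open>f\<close>
  is replaced by a multiple; the restriction of fractions then simply enlarges equivalence classes.
\<close>

definition power_divisors :: "('a, 'm) ring_scheme \<Rightarrow> 'a \<Rightarrow> 'a set" where
  "power_divisors R f = {s \<in> carrier R. \<exists>n :: nat. s divides\<^bsub>R\<^esub> (f [^]\<^bsub>R\<^esub> n)}"

definition sections_ring :: "('a, 'm) ring_scheme \<Rightarrow> 'a \<Rightarrow> 'a \<Rightarrow> (nat \<Rightarrow> ('a \<times> 'a) set set) ring" where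
  "sections_ring R w f =
     (let S = power_divisors R f in adic_completion (localization R S) (loc_map R S w))"

text \<open>Restriction of sections from \<open>D(f)\<close> to \<open>D(h)\<close>, where \<open>f\<close> divides \<open>h\<close>.\<close>

definition restrict_section ::
    "('a, 'm) ring_scheme \<Rightarrow> 'a \<Rightarrow> 'a \<Rightarrow> (nat \<Rightarrow> ('a \<times> 'a) set set) \<Rightarrow> (nat \<Rightarrow> ('a \<times> 'a) set set)" where
  "restrict_section R w h x =
     (let T = power_divisors R h; B = localization R T in
      (\<lambda>n. PIdl\<^bsub>B\<^esub> (loc_map R T w [^]\<^bsub>B\<^esub> n) <+>\<^bsub>B\<^esub> (\<lambda>X. frac_rel R T `` X) ` x n))"

definition germ_rel ::
    "('a, 'm) ring_scheme \<Rightarrow> 'a \<Rightarrow> 'a set \<Rightarrow>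
      (('a \<times> (nat \<Rightarrow> ('a \<times> 'a) set set)) \<times> ('a \<times> (nat \<Rightarrow> ('a \<times> 'a) set set))) set" where
  "germ_rel R w p =
     {((f, x), (g, y)).
        f \<in> carrier R - p \<and> x \<in> carrier (sections_ring R w f) \<and>
        g \<in> carrier R - p \<and> y \<in> carrier (sections_ring R w g) \<and>
        (\<exists>h\<in>carrier R - p. f divides\<^bsub>R\<^esub> h \<and> g divides\<^bsub>R\<^esub> h \<and>
           restrict_section R w h x = restrict_section R w h y)}"

text \<open>
  The local ring of \<open>Spf R\<close> at an open prime ideal \<open>p\<close>: the filtered colimit of the rings of
  sections on the basic open neighbourhoods \<open>D(f)\<close> of \<open>p\<close>.
\<close>

definition formal_stalk ::
    "('a, 'm) ring_scheme \<Rightarrow> 'a \<Rightarrow> 'a set \<Rightarrow> ('a \<times> (nat \<Rightarrow> ('a \<times> 'a) set set)) set ring" where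
  "formal_stalk R w p =
    \<lparr>carrier = (SIGMA f : carrier R - p. carrier (sections_ring R w f)) // germ_rel R w p,
     mult = (\<lambda>X Y. germ_rel R w p ``
       {(f \<otimes>\<^bsub>R\<^esub> g,
         restrict_section R w (f \<otimes>\<^bsub>R\<^esub> g) x
           \<otimes>\<^bsub>sections_ring R w (f \<otimes>\<^bsub>R\<^esub> g)\<^esub> restrict_section R w (f \<otimes>\<^bsub>R\<^esub> g) y)
        | f x g y. (f, x) \<in> X \<and> (g, y) \<in> Y}),
     one = germ_rel R w p `` {(\<one>\<^bsub>R\<^esub>, \<one>\<^bsub>sections_ring R w \<one>\<^bsub>R\<^esub>\<^esub>)},
     zero = germ_rel R w p `` {(\<one>\<^bsub>R\<^esub>, \<zero>\<^bsub>sections_ring R w \<one>\<^bsub>R\<^esub>\<^esub>)},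
     add = (\<lambda>X Y. germ_rel R w p ``
       {(f \<otimes>\<^bsub>R\<^esub> g,
         restrict_section R w (f \<otimes>\<^bsub>R\<^esub> g) x
           \<oplus>\<^bsub>sections_ring R w (f \<otimes>\<^bsub>R\<^esub> g)\<^esub> restrict_section R w (f \<otimes>\<^bsub>R\<^esub> g) y)
        | f x g y. (f, x) \<in> X \<and> (g, y) \<in> Y})\<rparr>"

definition integral_over :: "('a, 'm) ring_scheme \<Rightarrow> 'a set \<Rightarrow> 'a \<Rightarrow> bool" where
  "integral_over K A x \<longleftrightarrow>
     (\<exists>n :: nat. \<exists>c. c \<in> {..<n} \<rightarrow> A \<and>
        x [^]\<^bsub>K\<^esub> n \<oplus>\<^bsub>K\<^esub> (\<Oplus>\<^bsub>K\<^esub>i\<in>{..<n}. c i \<otimes>\<^bsub>K\<^esub> x [^]\<^bsub>K\<^esub> i) = \<zero>\<^bsub>K\<^esub>)"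

definition normal_domain :: "('a, 'm) ring_scheme \<Rightarrow> bool" where
  "normal_domain B \<longleftrightarrow> domain B \<and>
     (let S = carrier B - {\<zero>\<^bsub>B\<^esub>}; K = localization B S; B' = loc_map B S ` carrier B in
      \<forall>x\<in>carrier K. integral_over K B' x \<longrightarrow> x \<in> B')"

definition normal_formal_spectrum :: "('a, 'm) ring_scheme \<Rightarrow> 'a \<Rightarrow> bool" where
  "normal_formal_spectrum R w \<longleftrightarrow>
     (\<forall>p. primeideal p R \<and> w \<in> p \<longrightarrow> normal_domain (formal_stalk R w p))"

section \<open>Spectra and the reduced special fibre\<close>

definition zariski_space :: "('a, 'm) ring_scheme \<Rightarrow> 'a set topology" where
  "zariski_space A =
     topology (\<lambda>U. \<exists>S. S \<subseteq> carrier A \<and> U = {p. primeideal p A} - {p. primeideal p A \<and> S \<subseteq> p})"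

lemma openin_zariski_space:
  "openin (zariski_space A) U \<longleftrightarrow>
     (\<exists>S. S \<subseteq> carrier A \<and> U = {p. primeideal p A} - {p. primeideal p A \<and> S \<subseteq> p})"
proof -
  let ?P = "\<lambda>U. \<exists>S. S \<subseteq> carrier A \<and> U = {p. primeideal p A} - {p. primeideal p A \<and> S \<subseteq> p}"
  have Int: "?P (U \<inter> W)" if U: "?P U" and W: "?P W" for U W
  proof -
    obtain S where S: "S \<subseteq> carrier A"
      "U = {p. primeideal p A} - {p. primeideal p A \<and> S \<subseteq> p}" using U by blast
    obtain T where T: "T \<subseteq> carrier A"
      "W = {p. primeideal p A} - {p. primeideal p A \<and> T \<subseteq> p}" using W by blast
    let ?ST = "{s \<otimes>\<^bsub>A\<^esub> t | s t. s \<in> S \<and> t \<in> T}"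
    have eq: "?ST \<subseteq> p \<longleftrightarrow> S \<subseteq> p \<or> T \<subseteq> p" if p: "primeideal p A" for p
    proof
      assume st: "?ST \<subseteq> p"
      show "S \<subseteq> p \<or> T \<subseteq> p"
        using primeideal.I_prime[OF p] st S(1) T(1) by blast
    next
      interpret primeideal p A by (rule p)
      assume "S \<subseteq> p \<or> T \<subseteq> p"
      then show "?ST \<subseteq> p"
        using I_l_closed I_r_closed S(1) T(1) by blast
    qed
    have "?ST \<subseteq> carrier A \<or> (\<forall>p. \<not> primeideal p A)"
    proof (cases "\<exists>p. primeideal p A")
      case True
      then obtain p where "primeideal p A" by blast
      then interpret primeideal p A .
      show ?thesis using S(1) T(1) by blast
    qed simp
    then show ?thesis
    proof
      assume "?ST \<subseteq> carrier A"
      moreover have "U \<inter> W = {p. primeideal p A} - {p. primeideal p A \<and> ?ST \<subseteq> p}"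
        unfolding S(2) T(2) using eq by blast
      ultimately show ?thesis by blast
    next
      assume "\<forall>p. \<not> primeideal p A"
      then show ?thesis using S by (intro exI[of _ S]) auto
    qed
  qed
  have Un: "?P (\<Union>\<U>)" if \<U>: "\<forall>U\<in>\<U>. ?P U" for \<U>
  proof -
    obtain S where S: "\<forall>U\<in>\<U>. S U \<subseteq> carrier A \<and>
        U = {p. primeideal p A} - {p. primeideal p A \<and> S U \<subseteq> p}"
      using bchoice[OF \<U>] by blast
    have "\<Union>(S ` \<U>) \<subseteq> carrier A" using S by blast
    moreover have "\<Union>\<U> = {p. primeideal p A} - {p. primeideal p A \<and> \<Union>(S ` \<U>) \<subseteq> p}"
    proof (rule Set.set_eqI)
      fix p
      have "p \<in> U \<longleftrightarrow> primeideal p A \<and> \<not> S U \<subseteq> p" if "U \<in> \<U>" for U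
        using bspec[OF S that] by blast
      then show "p \<in> \<Union>\<U> \<longleftrightarrow>
          p \<in> {p. primeideal p A} - {p. primeideal p A \<and> \<Union>(S ` \<U>) \<subseteq> p}"
        by auto
    qed
    ultimately show ?thesis by blast
  qed
  have "istopology ?P"
    unfolding istopology_def using Int Un by blast
  then show ?thesis
    unfolding zariski_space_def by (simp add: topology_inverse')
qed

definition nilradical :: "('a, 'm) ring_scheme \<Rightarrow> 'a set" where
  "nilradical A = {a \<in> carrier A. \<exists>n :: nat. a [^]\<^bsub>A\<^esub> n = \<zero>\<^bsub>A\<^esub>}"

definition special_fiber_ring :: "('a, 'm) ring_scheme \<Rightarrow> 'a \<Rightarrow> 'a set ring" where
  "special_fiber_ring R w = R Quot (PIdl\<^bsub>R\<^esub> w)"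

text \<open>The coordinate ring of the affine scheme underlying the reduced special fibre.\<close>

definition reduced_special_fiber_ring :: "('a, 'm) ring_scheme \<Rightarrow> 'a \<Rightarrow> 'a set set ring" where
  "reduced_special_fiber_ring R w =
     special_fiber_ring R w Quot (nilradical (special_fiber_ring R w))"

section \<open>Valuations and adic spectra\<close>

definition ordered_abelian_group :: "('g, 'm) monoid_scheme \<Rightarrow> ('g \<Rightarrow> 'g \<Rightarrow> bool) \<Rightarrow> bool" where
  "ordered_abelian_group G leq \<longleftrightarrow>
     comm_group G \<and>
     (\<forall>a\<in>carrier G. \<forall>b\<in>carrier G. leq a b \<or> leq b a) \<and>
     (\<forall>a\<in>carrier G. \<forall>b\<in>carrier G. leq a b \<and> leq b a \<longrightarrow> a = b) \<and>
     (\<forall>a\<in>carrier G. \<forall>b\<in>carrier G. \<forall>c\<in>carrier G. leq a b \<and> leq b c \<longrightarrow> leq a c) \<and>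
     (\<forall>a\<in>carrier G. \<forall>b\<in>carrier G. \<forall>c\<in>carrier G. leq a b \<longrightarrow> leq (a \<otimes>\<^bsub>G\<^esub> c) (b \<otimes>\<^bsub>G\<^esub> c))"

text \<open>Values lie in the group with a smallest, absorbing element \<open>None\<close> (the value zero) adjoined.\<close>

fun val_le :: "('g \<Rightarrow> 'g \<Rightarrow> bool) \<Rightarrow> 'g option \<Rightarrow> 'g option \<Rightarrow> bool" where
  "val_le leq None y \<longleftrightarrow> True"
| "val_le leq (Some a) None \<longleftrightarrow> False"
| "val_le leq (Some a) (Some b) \<longleftrightarrow> leq a b"

fun val_mult :: "('g, 'm) monoid_scheme \<Rightarrow> 'g option \<Rightarrow> 'g option \<Rightarrow> 'g option" where
  "val_mult G (Some a) (Some b) = Some (a \<otimes>\<^bsub>G\<^esub> b)"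
| "val_mult G None y = None"
| "val_mult G x None = None"

definition valuation ::
    "('a, 'k) ring_scheme \<Rightarrow> ('g, 'm) monoid_scheme \<Rightarrow> ('g \<Rightarrow> 'g \<Rightarrow> bool) \<Rightarrow> ('a \<Rightarrow> 'g option) \<Rightarrow> bool" where
  "valuation A G leq v \<longleftrightarrow>
     ordered_abelian_group G leq \<and>
     v \<in> carrier A \<rightarrow> insert None (Some ` carrier G) \<and>
     v \<zero>\<^bsub>A\<^esub> = None \<and> v \<one>\<^bsub>A\<^esub> = Some \<one>\<^bsub>G\<^esub> \<and>
     (\<forall>a\<in>carrier A. \<forall>b\<in>carrier A. v (a \<otimes>\<^bsub>A\<^esub> b) = val_mult G (v a) (v b)) \<and>
     (\<forall>a\<in>carrier A. \<forall>b\<in>carrier A.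
        val_le leq (v (a \<oplus>\<^bsub>A\<^esub> b)) (v a) \<or> val_le leq (v (a \<oplus>\<^bsub>A\<^esub> b)) (v b))"

definition value_group ::
    "('a, 'k) ring_scheme \<Rightarrow> ('g, 'm) monoid_scheme \<Rightarrow> ('a \<Rightarrow> 'g option) \<Rightarrow> 'g set" where
  "value_group A G v = generate G {\<gamma>. Some \<gamma> \<in> v ` carrier A}"

definition continuous_valuation ::
    "('a, 'k) ring_scheme \<Rightarrow> 'a topology \<Rightarrow> ('g, 'm) monoid_scheme \<Rightarrow> ('g \<Rightarrow> 'g \<Rightarrow> bool) \<Rightarrow>
      ('a \<Rightarrow> 'g option) \<Rightarrow> bool" where
  "continuous_valuation A T G leq v \<longleftrightarrow>
     valuation A G leq v \<and>
     (\<forall>\<gamma>\<in>value_group A G v.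
        openin T {a \<in> carrier A. val_le leq (v a) (Some \<gamma>) \<and> v a \<noteq> Some \<gamma>})"

text \<open>
  Two valuations are equivalent iff they induce the same relation \<open>|a| \<le> |b|\<close> on the ring; this
  relation encodes the equivalence class.
\<close>

definition valuation_class ::
    "('a, 'k) ring_scheme \<Rightarrow> ('g \<Rightarrow> 'g \<Rightarrow> bool) \<Rightarrow> ('a \<Rightarrow> 'g option) \<Rightarrow> ('a \<times> 'a) set" where
  "valuation_class A leq v = {(a, b). a \<in> carrier A \<and> b \<in> carrier A \<and> val_le leq (v a) (v b)}"

text \<open>
  The set of equivalence classes of continuous valuations of \<open>A\<close> bounded by one on \<open>Aplus\<close>.  Value
  groups are taken on the type of sets of pairs of ring elements.  This loses no equivalence class:
  every element of the value group of a valuation is a quotient \<open>v(a)/v(b)\<close>, so it can be replaced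
  by the set of all pairs \<open>(a, b)\<close> that represent it.
\<close>

definition Spa_points :: "('a, 'k) ring_scheme \<Rightarrow> 'a topology \<Rightarrow> 'a set \<Rightarrow> ('a \<times> 'a) set set" where
  "Spa_points A T Aplus =
     {valuation_class A leq v | (G :: ('a \<times> 'a) set monoid) leq v.
        continuous_valuation A T G leq v \<and> (\<forall>a\<in>Aplus. val_le leq (v a) (Some \<one>\<^bsub>G\<^esub>))}"

definition Spa :: "('a, 'k) ring_scheme \<Rightarrow> 'a topology \<Rightarrow> 'a set \<Rightarrow> ('a \<times> 'a) set topology" where
  "Spa A T Aplus = topology_generated_by
     {{x \<in> Spa_points A T Aplus. (f, g) \<in> x \<and> (g, \<zero>\<^bsub>A\<^esub>) \<notin> x} | f g. f \<in> carrier A \<and> g \<in> carrier A}"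

section \<open>The adic generic fibre\<close>

definition generic_ring :: "('a, 'm) ring_scheme \<Rightarrow> 'a \<Rightarrow> ('a \<times> 'a) set ring" where
  "generic_ring R w = localization R (powers R w)"

definition generic_map :: "('a, 'm) ring_scheme \<Rightarrow> 'a \<Rightarrow> 'a \<Rightarrow> ('a \<times> 'a) set" where
  "generic_map R w = loc_map R (powers R w)"

text \<open>
  The topology on \<open>R[1/w]\<close> for which the image of \<open>R\<close> is an open subring carrying the \<open>w\<close>-adic
  topology: it has the translates of the images of the ideals \<open>w\<^sup>nR\<close> as a basis.
\<close>

definition generic_topology :: "('a, 'm) ring_scheme \<Rightarrow> 'a \<Rightarrow> ('a \<times> 'a) set topology" where
  "generic_topology R w = topology_generated_by
     {(generic_map R w ` (PIdl\<^bsub>R\<^esub> (w [^]\<^bsub>R\<^esub> (n :: nat)))) +>\<^bsub>generic_ring R w\<^esub> u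
       | n u. u \<in> carrier (generic_ring R w)}"

definition adic_generic_fiber ::
    "('a, 'm) ring_scheme \<Rightarrow> 'a \<Rightarrow> (('a \<times> 'a) set \<times> ('a \<times> 'a) set) set topology" where
  "adic_generic_fiber R w =
     Spa (generic_ring R w) (generic_topology R w) (generic_map R w ` carrier R)"

section \<open>Specialization\<close>

definition sp :: "('a, 'm) ring_scheme \<Rightarrow> 'a \<Rightarrow> (('a \<times> 'a) set \<times> ('a \<times> 'a) set) set \<Rightarrow> 'a set set" where
  "sp R w x = {PIdl\<^bsub>R\<^esub> w +>\<^bsub>R\<^esub> a | a. a \<in> carrier R \<and>
     (generic_map R w a, \<one>\<^bsub>generic_ring R w\<^esub>) \<in> x \<and>
     (\<one>\<^bsub>generic_ring R w\<^esub>, generic_map R w a) \<notin> x}"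

definition generalizes :: "'x topology \<Rightarrow> 'x \<Rightarrow> 'x \<Rightarrow> bool" where
  "generalizes X y x \<longleftrightarrow> y \<in> topspace X \<and> x \<in> X closure_of {y}"

definition maximal_generalization :: "'x topology \<Rightarrow> 'x \<Rightarrow> 'x" where
  "maximal_generalization X x =
     (THE y. generalizes X y x \<and> (\<forall>z. generalizes X z y \<longrightarrow> z = y))"

definition sp_max ::
    "('a, 'm) ring_scheme \<Rightarrow> 'a \<Rightarrow> (('a \<times> 'a) set \<times> ('a \<times> 'a) set) set \<Rightarrow> 'a set set" where
  "sp_max R w x = sp R w (maximal_generalization (adic_generic_fiber R w) x)"

definition anticontinuous_map :: "'x topology \<Rightarrow> 'y topology \<Rightarrow> ('x \<Rightarrow> 'y) \<Rightarrow> bool" where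
  "anticontinuous_map X Y f \<longleftrightarrow>
     f \<in> topspace X \<rightarrow> topspace Y \<and>
     (\<forall>C. closedin Y C \<longrightarrow> openin X {x \<in> topspace X. f x \<in> C}) \<and>
     (\<forall>U. openin Y U \<longrightarrow> closedin X {x \<in> topspace X. f x \<in> U})"

end

theory Submission
  imports Defs
begin

text \<open>
  Write \<open>A = R[1/w]\<close>, where \<open>w\<close> is the image of the pseudo-uniformizer.  The theorem comes down to
  the following description of the function \<open>x \<mapsto> |a(x\<^sub>m\<^sub>a\<^sub>x)|\<close> for \<open>a \<in> R\<close>: one has
  \<open>|a(x\<^sub>m\<^sub>a\<^sub>x)| < 1\<close> iff \<open>|a(x)|\<^sup>n \<le> |w(x)|\<close> for some \<open>n\<close>.  At a point of rank one this is the
  archimedean property, and between \<open>x\<close> and its generalization the inequality can be moved in both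
  directions, at the cost of increasing \<open>n\<close>.  Since \<open>w\<close> is a unit of \<open>A\<close>, the set of all such \<open>x\<close>
  is a union of basic open subsets of the adic spectrum.  A closed subset of the special fibre is cut
  out by finitely many functions, because the reduction is noetherian; hence its preimage under the
  maximal specialization map is a finite intersection of such open sets.  Preimages of open subsets
  are the complements.

  Most of the work is to identify the maximal generalization.  A point is a relation
  \<open>|a| \<le> |b|\<close> on \<open>A\<close>, and the relation of \<open>x\<^sub>m\<^sub>a\<^sub>x\<close> is defined directly from that of \<open>x\<close>:
  \<open>|a| \<le> |b|\<close> holds at \<open>x\<^sub>m\<^sub>a\<^sub>x\<close> iff \<open>|a\<^sup>n w| \<le> |b\<^sup>n|\<close> at \<open>x\<close> for all \<open>n\<close>
  (\<open>max_gen\<close>).  This relation comes from a continuous valuation (\<open>max_gen_point\<close>): one divides the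
  value group of \<open>x\<close> by its largest convex subgroup that does not contain \<open>|w|\<close>.  That it is the
  unique maximal generalization follows from three facts about an arbitrary generalization \<open>y\<close> of
  \<open>x\<close>: it has the same support as \<open>x\<close>, by continuity; its relation is contained in that of \<open>max_gen x\<close>,
  since a strict inequality of the opposite kind at \<open>x\<close> would persist at \<open>y\<close>; and therefore
  \<open>max_gen x\<close> is also a generalization of \<open>y\<close>.
\<close>

section \<open>Rings of fractions\<close>

locale mult_subset = cring R for R (structure) +
  fixes S
  assumes S_subset: "S \<subseteq> carrier R"
    and one_in: "\<one> \<in> S"
    and mult_in: "\<lbrakk>s \<in> S; t \<in> S\<rbrakk> \<Longrightarrow> s \<otimes> t \<in> S"
begin

abbreviation frac :: "'a \<Rightarrow> 'a \<Rightarrow> ('a \<times> 'a) set" where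
  "frac a s \<equiv> frac_rel R S `` {(a, s)}"

lemma S_closed [simp]: "s \<in> S \<Longrightarrow> s \<in> carrier R"
  using S_subset by blast

lemma frac_rel_iff:
  "((a, s), (b, t)) \<in> frac_rel R S \<longleftrightarrow> a \<in> carrier R \<and> b \<in> carrier R \<and> s \<in> S \<and> t \<in> S \<and>
     (\<exists>u\<in>S. u \<otimes> (t \<otimes> a) = u \<otimes> (s \<otimes> b))"
  by (simp add: frac_rel_def)

lemma equiv_frac_rel: "equiv (carrier R \<times> S) (frac_rel R S)"
proof (rule equivI)
  show "frac_rel R S \<subseteq> (carrier R \<times> S) \<times> carrier R \<times> S"
    by (auto simp: frac_rel_def)
  show "refl_on (carrier R \<times> S) (frac_rel R S)"
    by (rule refl_onI) (use one_in in \<open>auto simp: frac_rel_def\<close>)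
  show "sym (frac_rel R S)"
    by (rule symI) (auto simp: frac_rel_def eq_commute)
  show "trans (frac_rel R S)"
  proof (rule transI, clarify)
    fix a s b t c r
    assume "((a, s), (b, t)) \<in> frac_rel R S" "((b, t), (c, r)) \<in> frac_rel R S"
    then obtain u u' where
      mem: "a \<in> carrier R" "b \<in> carrier R" "c \<in> carrier R" "s \<in> S" "t \<in> S" "r \<in> S" "u \<in> S" "u' \<in> S"
      and u: "u \<otimes> (t \<otimes> a) = u \<otimes> (s \<otimes> b)" and u': "u' \<otimes> (r \<otimes> b) = u' \<otimes> (t \<otimes> c)"
      unfolding frac_rel_iff by blast
    have "(u \<otimes> u' \<otimes> t) \<otimes> (r \<otimes> a) = (u' \<otimes> r) \<otimes> (u \<otimes> (t \<otimes> a))"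
      using mem by (simp add: m_ac)
    also have "\<dots> = (u \<otimes> s) \<otimes> (u' \<otimes> (r \<otimes> b))"
      unfolding u using mem by (simp add: m_ac)
    also have "\<dots> = (u \<otimes> u' \<otimes> t) \<otimes> (s \<otimes> c)"
      unfolding u' using mem by (simp add: m_ac)
    finally show "((a, s), (c, r)) \<in> frac_rel R S"
      unfolding frac_rel_iff using mem by (auto intro!: mult_in)
  qed
qed

lemma frac_eq_iff:
  assumes "a \<in> carrier R" "b \<in> carrier R" "s \<in> S" "t \<in> S"
  shows "frac a s = frac b t \<longleftrightarrow> ((a, s), (b, t)) \<in> frac_rel R S"
  by (rule eq_equiv_class_iff[OF equiv_frac_rel]) (use assms in auto)

lemma frac_eqI:
  assumes "a \<in> carrier R" "b \<in> carrier R" "s \<in> S" "t \<in> S" "t \<otimes> a = s \<otimes> b"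
  shows "frac a s = frac b t"
  unfolding frac_eq_iff[OF assms(1-4)] frac_rel_iff using assms one_in by auto

lemma carrier_localization: "carrier (localization R S) = {frac a s | a s. a \<in> carrier R \<and> s \<in> S}"
  by (auto simp: localization_def quotient_def)

lemma frac_closed [simp]:
  "\<lbrakk>a \<in> carrier R; s \<in> S\<rbrakk> \<Longrightarrow> frac a s \<in> carrier (localization R S)"
  by (auto simp: carrier_localization)

lemma localization_elem:
  assumes "x \<in> carrier (localization R S)"
  obtains a s where "a \<in> carrier R" "s \<in> S" "x = frac a s"
  using assms by (auto simp: carrier_localization)

lemma frac_self: "\<lbrakk>a \<in> carrier R; s \<in> S\<rbrakk> \<Longrightarrow> (a, s) \<in> frac a s"
  by (rule equiv_class_self[OF equiv_frac_rel]) simp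

text \<open>This reduces the computation of an operation on fractions to one choice of representatives.\<close>

lemma saturation_eq_class:
  assumes "z \<in> Z" and "\<And>y. y \<in> Z \<Longrightarrow> (z, y) \<in> frac_rel R S"
  shows "frac_rel R S `` Z = frac_rel R S `` {z}"
proof
  show "frac_rel R S `` Z \<subseteq> frac_rel R S `` {z}"
    using assms(2) equiv_frac_rel unfolding equiv_def trans_def by blast
qed (use assms(1) in blast)

lemma mult_frac:
  assumes "a \<in> carrier R" "b \<in> carrier R" "s \<in> S" "t \<in> S"
  shows "frac a s \<otimes>\<^bsub>localization R S\<^esub> frac b t = frac (a \<otimes> b) (s \<otimes> t)"
proof -
  have "frac_rel R S `` {(a' \<otimes> b', s' \<otimes> t') | a' s' b' t'. (a', s') \<in> frac a s \<and> (b', t') \<in> frac b t}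
     = frac (a \<otimes> b) (s \<otimes> t)"
  proof (rule saturation_eq_class)
    show "(a \<otimes> b, s \<otimes> t) \<in> {(a' \<otimes> b', s' \<otimes> t') | a' s' b' t'. (a', s') \<in> frac a s \<and> (b', t') \<in> frac b t}"
      using frac_self[OF assms(1,3)] frac_self[OF assms(2,4)] by fast
  next
    fix y
    assume "y \<in> {(a' \<otimes> b', s' \<otimes> t') | a' s' b' t'. (a', s') \<in> frac a s \<and> (b', t') \<in> frac b t}"
    then obtain a' s' b' t' where y: "y = (a' \<otimes> b', s' \<otimes> t')"
      and "((a, s), (a', s')) \<in> frac_rel R S" "((b, t), (b', t')) \<in> frac_rel R S" by auto
    then obtain u u' where mem: "a' \<in> carrier R" "b' \<in> carrier R" "s' \<in> S" "t' \<in> S" "u \<in> S" "u' \<in> S"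
      and u: "u \<otimes> (s' \<otimes> a) = u \<otimes> (s \<otimes> a')" and u': "u' \<otimes> (t' \<otimes> b) = u' \<otimes> (t \<otimes> b')"
      unfolding frac_rel_iff by blast
    have "(u \<otimes> u') \<otimes> ((s' \<otimes> t') \<otimes> (a \<otimes> b)) = (u \<otimes> (s' \<otimes> a)) \<otimes> (u' \<otimes> (t' \<otimes> b))"
      using assms mem by (simp add: m_ac)
    also have "\<dots> = (u \<otimes> u') \<otimes> ((s \<otimes> t) \<otimes> (a' \<otimes> b'))"
      unfolding u u' using assms mem by (simp add: m_ac)
    finally show "((a \<otimes> b, s \<otimes> t), y) \<in> frac_rel R S"
      unfolding y frac_rel_iff using assms mem by (auto intro!: mult_in)
  qed
  then show ?thesis by (simp add: localization_def)
qed

lemma add_frac: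
  assumes "a \<in> carrier R" "b \<in> carrier R" "s \<in> S" "t \<in> S"
  shows "frac a s \<oplus>\<^bsub>localization R S\<^esub> frac b t = frac ((a \<otimes> t) \<oplus> (b \<otimes> s)) (s \<otimes> t)"
proof -
  let ?Z = "{((a' \<otimes> t') \<oplus> (b' \<otimes> s'), s' \<otimes> t') | a' s' b' t'. (a', s') \<in> frac a s \<and> (b', t') \<in> frac b t}"
  have "frac_rel R S `` ?Z = frac ((a \<otimes> t) \<oplus> (b \<otimes> s)) (s \<otimes> t)"
  proof (rule saturation_eq_class)
    show "((a \<otimes> t) \<oplus> (b \<otimes> s), s \<otimes> t) \<in> ?Z"
      using frac_self[OF assms(1,3)] frac_self[OF assms(2,4)] by fast
  next
    fix y
    assume "y \<in> ?Z"
    then obtain a' s' b' t' where y: "y = ((a' \<otimes> t') \<oplus> (b' \<otimes> s'), s' \<otimes> t')"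
      and "((a, s), (a', s')) \<in> frac_rel R S" "((b, t), (b', t')) \<in> frac_rel R S" by auto
    then obtain u u' where mem: "a' \<in> carrier R" "b' \<in> carrier R" "s' \<in> S" "t' \<in> S" "u \<in> S" "u' \<in> S"
      and u: "u \<otimes> (s' \<otimes> a) = u \<otimes> (s \<otimes> a')" and u': "u' \<otimes> (t' \<otimes> b) = u' \<otimes> (t \<otimes> b')"
      unfolding frac_rel_iff by blast
    have "(u \<otimes> u') \<otimes> ((s' \<otimes> t') \<otimes> ((a \<otimes> t) \<oplus> (b \<otimes> s)))
        = (u' \<otimes> t' \<otimes> t) \<otimes> (u \<otimes> (s' \<otimes> a)) \<oplus> (u \<otimes> s' \<otimes> s) \<otimes> (u' \<otimes> (t' \<otimes> b))"
      using assms mem by (simp add: r_distr m_ac)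
    also have "\<dots> = (u \<otimes> u') \<otimes> ((s \<otimes> t) \<otimes> ((a' \<otimes> t') \<oplus> (b' \<otimes> s')))"
      unfolding u u' using assms mem by (simp add: r_distr m_ac)
    finally show "(((a \<otimes> t) \<oplus> (b \<otimes> s), s \<otimes> t), y) \<in> frac_rel R S"
      unfolding y frac_rel_iff using assms mem by (auto intro!: mult_in)
  qed
  then show ?thesis by (simp add: localization_def)
qed

lemma one_localization: "\<one>\<^bsub>localization R S\<^esub> = frac \<one> \<one>"
  and zero_localization: "\<zero>\<^bsub>localization R S\<^esub> = frac \<zero> \<one>"
  by (simp_all add: localization_def)

lemma cring_localization: "cring (localization R S)"
proof (rule cringI)
  note fr = mult_frac add_frac one_localization zero_localization mult_in one_in
  show "abelian_group (localization R S)"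
  proof (rule abelian_groupI)
    fix x assume "x \<in> carrier (localization R S)"
    then obtain a s where x: "a \<in> carrier R" "s \<in> S" "x = frac a s" by (rule localization_elem)
    show "\<zero>\<^bsub>localization R S\<^esub> \<oplus>\<^bsub>localization R S\<^esub> x = x"
      using x by (simp add: fr)
    have "frac (\<ominus> a) s \<oplus>\<^bsub>localization R S\<^esub> x = \<zero>\<^bsub>localization R S\<^esub>"
      using x by (simp add: fr l_minus l_neg) (rule frac_eqI; simp add: fr)
    then show "\<exists>y\<in>carrier (localization R S). y \<oplus>\<^bsub>localization R S\<^esub> x = \<zero>\<^bsub>localization R S\<^esub>"
      using x by (intro bexI[of _ "frac (\<ominus> a) s"]) auto
  next
    fix x y assume "x \<in> carrier (localization R S)" "y \<in> carrier (localization R S)"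
    then obtain a s b t where x: "a \<in> carrier R" "s \<in> S" "x = frac a s"
      "b \<in> carrier R" "t \<in> S" "y = frac b t" by (metis localization_elem)
    show "x \<oplus>\<^bsub>localization R S\<^esub> y \<in> carrier (localization R S)"
      using x by (simp add: fr)
    show "x \<oplus>\<^bsub>localization R S\<^esub> y = y \<oplus>\<^bsub>localization R S\<^esub> x"
      using x by (simp add: fr m_comm a_comm)
    fix z assume "z \<in> carrier (localization R S)"
    then obtain c u where z: "c \<in> carrier R" "u \<in> S" "z = frac c u" by (rule localization_elem)
    show "x \<oplus>\<^bsub>localization R S\<^esub> y \<oplus>\<^bsub>localization R S\<^esub> z
        = x \<oplus>\<^bsub>localization R S\<^esub> (y \<oplus>\<^bsub>localization R S\<^esub> z)"
      using x z by (simp add: fr l_distr r_distr m_ac a_ac)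
  qed (simp add: fr)
  show "comm_monoid (localization R S)"
  proof (rule comm_monoidI)
    fix x assume "x \<in> carrier (localization R S)"
    then obtain a s where x: "a \<in> carrier R" "s \<in> S" "x = frac a s" by (rule localization_elem)
    show "\<one>\<^bsub>localization R S\<^esub> \<otimes>\<^bsub>localization R S\<^esub> x = x"
      using x by (simp add: fr)
  next
    fix x y assume "x \<in> carrier (localization R S)" "y \<in> carrier (localization R S)"
    then obtain a s b t where x: "a \<in> carrier R" "s \<in> S" "x = frac a s"
      "b \<in> carrier R" "t \<in> S" "y = frac b t" by (metis localization_elem)
    show "x \<otimes>\<^bsub>localization R S\<^esub> y \<in> carrier (localization R S)"
      using x by (simp add: fr)
    show "x \<otimes>\<^bsub>localization R S\<^esub> y = y \<otimes>\<^bsub>localization R S\<^esub> x"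
      using x by (simp add: fr m_comm)
    fix z assume "z \<in> carrier (localization R S)"
    then obtain c u where z: "c \<in> carrier R" "u \<in> S" "z = frac c u" by (rule localization_elem)
    show "x \<otimes>\<^bsub>localization R S\<^esub> y \<otimes>\<^bsub>localization R S\<^esub> z
        = x \<otimes>\<^bsub>localization R S\<^esub> (y \<otimes>\<^bsub>localization R S\<^esub> z)"
      using x z by (simp add: fr m_assoc)
  qed (simp add: fr)
next
  note fr = mult_frac add_frac one_localization zero_localization mult_in one_in
  fix x y z assume "x \<in> carrier (localization R S)" "y \<in> carrier (localization R S)"
    "z \<in> carrier (localization R S)"
  then obtain a s b t c u where x: "a \<in> carrier R" "s \<in> S" "x = frac a s"
    "b \<in> carrier R" "t \<in> S" "y = frac b t" "c \<in> carrier R" "u \<in> S" "z = frac c u"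
    by (metis localization_elem)
  show "(x \<oplus>\<^bsub>localization R S\<^esub> y) \<otimes>\<^bsub>localization R S\<^esub> z
      = x \<otimes>\<^bsub>localization R S\<^esub> z \<oplus>\<^bsub>localization R S\<^esub> y \<otimes>\<^bsub>localization R S\<^esub> z"
    using x by (simp add: fr) (rule frac_eqI; simp add: fr l_distr r_distr m_ac)
qed

lemma loc_map_hom: "loc_map R S \<in> ring_hom R (localization R S)"
  by (rule ring_hom_memI)
    (simp_all add: loc_map_def mult_frac add_frac one_localization one_in)

lemma loc_map_unit: "s \<in> S \<Longrightarrow> loc_map R S s \<in> Units (localization R S)"
proof -
  assume s: "s \<in> S"
  interpret L: cring "localization R S" by (rule cring_localization)
  have inv: "frac \<one> s \<otimes>\<^bsub>localization R S\<^esub> loc_map R S s = \<one>\<^bsub>localization R S\<^esub>"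
    using s by (simp add: loc_map_def mult_frac one_localization one_in) (rule frac_eqI; simp add: one_in)
  have mem: "frac \<one> s \<in> carrier (localization R S)" "loc_map R S s \<in> carrier (localization R S)"
    using s one_in by (simp_all add: loc_map_def)
  then have "loc_map R S s \<otimes>\<^bsub>localization R S\<^esub> frac \<one> s = \<one>\<^bsub>localization R S\<^esub>"
    using inv by (simp add: L.m_comm)
  with inv mem show ?thesis
    unfolding Units_def by blast
qed

end

lemma (in cring) mult_subset_powers:
  assumes "f \<in> carrier R"
  shows "mult_subset R (powers R f)"
proof
  show "powers R f \<subseteq> carrier R" using assms by (auto simp: powers_def)
  show "\<one> \<in> powers R f" unfolding powers_def by (auto intro!: exI[of _ "0::nat"])
  show "s \<otimes> t \<in> powers R f" if "s \<in> powers R f" "t \<in> powers R f" for s t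
    using that assms unfolding powers_def by (auto simp: nat_pow_mult)
qed

section \<open>Coarsening the order of a value group\<close>

locale ordered_comm_group = comm_group G for G (structure) +
  fixes leq :: "'a \<Rightarrow> 'a \<Rightarrow> bool" (infix "\<preceq>" 50)
  assumes total: "\<lbrakk>a \<in> carrier G; b \<in> carrier G\<rbrakk> \<Longrightarrow> a \<preceq> b \<or> b \<preceq> a"
    and antisym: "\<lbrakk>a \<preceq> b; b \<preceq> a; a \<in> carrier G; b \<in> carrier G\<rbrakk> \<Longrightarrow> a = b"
    and trans: "\<lbrakk>a \<preceq> b; b \<preceq> c; a \<in> carrier G; b \<in> carrier G; c \<in> carrier G\<rbrakk> \<Longrightarrow> a \<preceq> c"
    and mult_right_mono:
      "\<lbrakk>a \<preceq> b; a \<in> carrier G; b \<in> carrier G; c \<in> carrier G\<rbrakk> \<Longrightarrow> a \<otimes> c \<preceq> b \<otimes> c"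

lemma ordered_abelian_group_iff: "ordered_abelian_group G leq \<longleftrightarrow> ordered_comm_group G leq"
proof
  assume "ordered_abelian_group G leq"
  note * = this[unfolded ordered_abelian_group_def]
  show "ordered_comm_group G leq"
  proof (intro ordered_comm_group.intro ordered_comm_group_axioms.intro)
    show "comm_group G" using * by (rule conjunct1)
    show "leq a b \<or> leq b a" if "a \<in> carrier G" "b \<in> carrier G" for a b
      using *[THEN conjunct2, THEN conjunct1] that by simp
    show "a = b" if "leq a b" "leq b a" "a \<in> carrier G" "b \<in> carrier G" for a b
      using *[THEN conjunct2, THEN conjunct2, THEN conjunct1] that by simp
    show "leq a c" if "leq a b" "leq b c" "a \<in> carrier G" "b \<in> carrier G" "c \<in> carrier G" for a b c
      using *[THEN conjunct2, THEN conjunct2, THEN conjunct2, THEN conjunct1] that by fast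
    show "leq (a \<otimes>\<^bsub>G\<^esub> c) (b \<otimes>\<^bsub>G\<^esub> c)" if "leq a b" "a \<in> carrier G" "b \<in> carrier G" "c \<in> carrier G" for a b c
      using *[THEN conjunct2, THEN conjunct2, THEN conjunct2, THEN conjunct2] that by simp
  qed
next
  assume "ordered_comm_group G leq"
  then interpret ordered_comm_group G leq .
  show "ordered_abelian_group G leq"
    unfolding ordered_abelian_group_def
    by (intro conjI ballI impI; (elim conjE)?) (rule comm_group_axioms total antisym trans mult_right_mono; assumption)+
qed

context ordered_comm_group
begin

lemma refl: "a \<in> carrier G \<Longrightarrow> a \<preceq> a"
  using total by blast

lemma mult_mono:
  assumes "a \<preceq> b" "c \<preceq> d" "a \<in> carrier G" "b \<in> carrier G" "c \<in> carrier G" "d \<in> carrier G"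
  shows "a \<otimes> c \<preceq> b \<otimes> d"
proof (rule trans)
  show "a \<otimes> c \<preceq> b \<otimes> c" using assms by (intro mult_right_mono)
  show "b \<otimes> c \<preceq> b \<otimes> d" using assms mult_right_mono[of c d b] by (simp add: m_comm)
qed (use assms in auto)

lemma mult_right_cancel:
  assumes "a \<otimes> c \<preceq> b \<otimes> c" "a \<in> carrier G" "b \<in> carrier G" "c \<in> carrier G"
  shows "a \<preceq> b"
  using mult_right_mono[OF assms(1), of "inv c"] assms(2-) by (simp add: m_assoc)

lemma pow_mono:
  assumes "a \<preceq> b" "a \<in> carrier G" "b \<in> carrier G"
  shows "a [^] (n::nat) \<preceq> b [^] n"
  by (induction n) (use assms in \<open>auto intro: refl mult_mono\<close>)

lemma pow_le_imp_le:
  assumes "a [^] (n::nat) \<preceq> b [^] n" "0 < n" "a \<in> carrier G" "b \<in> carrier G"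
  shows "a \<preceq> b"
proof (rule ccontr)
  assume not: "\<not> a \<preceq> b"
  then have ba: "b \<preceq> a" using total assms by blast
  obtain k where n: "n = Suc k" using assms(2) by (cases n) auto
  have "b [^] k \<otimes> b \<preceq> a [^] k \<otimes> b"
    using ba assms by (auto intro: mult_right_mono pow_mono)
  moreover have "a [^] k \<otimes> a \<preceq> b [^] k \<otimes> b"
    using assms n by simp
  ultimately have "a [^] k \<otimes> a \<preceq> a [^] k \<otimes> b"
    using assms by (auto intro: trans)
  then have "a \<preceq> b"
    using mult_right_cancel[of a "a [^] k" b] assms by (simp add: m_comm)
  with not show False by contradiction
qed

text \<open>
  The quotient of the group by the elements that are equivalent to the unit under a coarser
  compatible preorder.  It is realised on representatives and not on cosets, because the value groups
  of the points of an adic spectrum all have to live on the same type.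
\<close>

definition coarse_rep :: "('a \<Rightarrow> 'a \<Rightarrow> bool) \<Rightarrow> 'a \<Rightarrow> 'a" where
  "coarse_rep ple a = (SOME b. b \<in> carrier G \<and> ple a b \<and> ple b a)"

definition coarse_group :: "('a \<Rightarrow> 'a \<Rightarrow> bool) \<Rightarrow> 'a monoid" where
  "coarse_group ple =
     \<lparr>carrier = coarse_rep ple ` carrier G, mult = (\<lambda>a b. coarse_rep ple (a \<otimes> b)), one = coarse_rep ple \<one>\<rparr>"

end

locale coarser_order = ordered_comm_group +
  fixes ple :: "'a \<Rightarrow> 'a \<Rightarrow> bool"
  assumes ple_coarser: "\<lbrakk>a \<preceq> b; a \<in> carrier G; b \<in> carrier G\<rbrakk> \<Longrightarrow> ple a b"
    and ple_trans: "\<lbrakk>ple a b; ple b c; a \<in> carrier G; b \<in> carrier G; c \<in> carrier G\<rbrakk> \<Longrightarrow> ple a c"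
    and ple_mult: "\<lbrakk>ple a b; a \<in> carrier G; b \<in> carrier G; c \<in> carrier G\<rbrakk> \<Longrightarrow> ple (a \<otimes> c) (b \<otimes> c)"
begin

abbreviation rep :: "'a \<Rightarrow> 'a" where "rep \<equiv> coarse_rep ple"
abbreviation Q :: "'a monoid" where "Q \<equiv> coarse_group ple"

lemma rep_props:
  assumes "a \<in> carrier G"
  shows "rep a \<in> carrier G" "ple a (rep a)" "ple (rep a) a"
proof -
  have "rep a \<in> carrier G \<and> ple a (rep a) \<and> ple (rep a) a"
    unfolding coarse_rep_def by (rule someI[of _ a]) (use assms ple_coarser refl in auto)
  then show "rep a \<in> carrier G" "ple a (rep a)" "ple (rep a) a" by auto
qed

lemma rep_eqI:
  assumes "ple a b" "ple b a" "a \<in> carrier G" "b \<in> carrier G"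
  shows "rep a = rep b"
proof -
  have "(c \<in> carrier G \<and> ple a c \<and> ple c a) = (c \<in> carrier G \<and> ple b c \<and> ple c b)" for c
    using assms ple_trans by blast
  then show ?thesis unfolding coarse_rep_def by presburger
qed

lemma ple_rep_iff:
  assumes "a \<in> carrier G" "b \<in> carrier G"
  shows "ple (rep a) (rep b) \<longleftrightarrow> ple a b"
  using assms rep_props ple_trans by meson

lemma ple_mult_both:
  assumes "ple a b" "ple c d" "a \<in> carrier G" "b \<in> carrier G" "c \<in> carrier G" "d \<in> carrier G"
  shows "ple (a \<otimes> c) (b \<otimes> d)"
proof (rule ple_trans)
  show "ple (a \<otimes> c) (b \<otimes> c)" using assms by (intro ple_mult)
  show "ple (b \<otimes> c) (b \<otimes> d)" using assms ple_mult[of c d b] by (simp add: m_comm)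
qed (use assms in auto)

lemma rep_mult_rep:
  assumes "a \<in> carrier G" "b \<in> carrier G"
  shows "rep (rep a \<otimes> rep b) = rep (a \<otimes> b)"
  using assms rep_props by (intro rep_eqI ple_mult_both) auto

lemma carrier_coarse_group: "carrier Q = rep ` carrier G"
  and mult_coarse_group: "\<lbrakk>a \<in> carrier G; b \<in> carrier G\<rbrakk> \<Longrightarrow> rep a \<otimes>\<^bsub>Q\<^esub> rep b = rep (a \<otimes> b)"
  and one_coarse_group: "\<one>\<^bsub>Q\<^esub> = rep \<one>"
  by (auto simp: coarse_group_def rep_mult_rep)

lemma comm_group_coarse_group: "comm_group Q"
proof (rule comm_groupI)
  fix x assume "x \<in> carrier Q"
  then obtain a where a: "a \<in> carrier G" "x = rep a" by (auto simp: carrier_coarse_group)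
  show "\<one>\<^bsub>Q\<^esub> \<otimes>\<^bsub>Q\<^esub> x = x"
    using a by (simp add: one_coarse_group mult_coarse_group)
  have "rep (inv a) \<otimes>\<^bsub>Q\<^esub> x = \<one>\<^bsub>Q\<^esub>"
    using a by (simp add: one_coarse_group mult_coarse_group)
  then show "\<exists>y\<in>carrier Q. y \<otimes>\<^bsub>Q\<^esub> x = \<one>\<^bsub>Q\<^esub>"
    using a by (auto simp: carrier_coarse_group)
qed (auto simp: carrier_coarse_group mult_coarse_group one_coarse_group m_ac)

lemma ordered_abelian_group_coarse_group: "ordered_abelian_group Q ple"
  unfolding ordered_abelian_group_def carrier_coarse_group
proof (intro conjI ballI impI; (elim imageE conjE)?)
  show "comm_group Q" by (rule comm_group_coarse_group)
next
  fix x y a b assume "x = rep a" "y = rep b" "a \<in> carrier G" "b \<in> carrier G"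
  then show "ple x y \<or> ple y x" using total ple_coarser by (auto simp: ple_rep_iff)
next
  fix x y a b assume "x = rep a" "y = rep b" "a \<in> carrier G" "b \<in> carrier G" "ple x y" "ple y x"
  then show "x = y" using rep_eqI[of a b] by (simp add: ple_rep_iff)
next
  fix x y z a b c assume "x = rep a" "y = rep b" "z = rep c"
    "a \<in> carrier G" "b \<in> carrier G" "c \<in> carrier G" "ple x y" "ple y z"
  then show "ple x z" using ple_trans[of a b c] by (simp add: ple_rep_iff)
next
  fix x y z a b c assume "x = rep a" "y = rep b" "z = rep c"
    "a \<in> carrier G" "b \<in> carrier G" "c \<in> carrier G" "ple x y"
  then show "ple (x \<otimes>\<^bsub>Q\<^esub> z) (y \<otimes>\<^bsub>Q\<^esub> z)" by (simp add: ple_rep_iff mult_coarse_group ple_mult)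
qed

lemma rep_group_hom: "group_hom G Q rep"
proof (intro group_hom.intro group_hom_axioms.intro homI)
  show "group Q" using comm_group_coarse_group by (rule comm_group.axioms(2))
qed (auto simp: carrier_coarse_group mult_coarse_group)

end

context ordered_comm_group
begin

text \<open>
  For \<open>p\<close> at most the unit, the coarser order makes infinitesimal everything whose powers stay
  between \<open>p\<close> and its inverse: these elements form the largest convex subgroup that avoids \<open>p\<close>
  when \<open>p\<close> is less than the unit.
\<close>

definition arch_le :: "'a \<Rightarrow> 'a \<Rightarrow> 'a \<Rightarrow> bool" where
  "arch_le p a b \<longleftrightarrow> (\<forall>n::nat. a [^] n \<otimes> p \<preceq> b [^] n)"

lemma arch_le_coarser:
  assumes p: "p \<in> carrier G" "p \<preceq> \<one>"
  shows "coarser_order G leq (arch_le p)"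
proof
  fix a b assume ab: "a \<preceq> b" "a \<in> carrier G" "b \<in> carrier G"
  have "a [^] n \<otimes> p \<preceq> b [^] n" for n :: nat
    using mult_mono[OF pow_mono[OF ab] p(2), of n] p ab by simp
  then show "arch_le p a b" by (simp add: arch_le_def)
next
  fix a b c assume ab: "arch_le p a b" and bc: "arch_le p b c"
    and mem: "a \<in> carrier G" "b \<in> carrier G" "c \<in> carrier G"
  have "a [^] n \<otimes> p \<preceq> c [^] n" for n :: nat
  proof -
    \<comment> \<open>Composing the two bounds costs a factor \<open>p\<close>; it is recovered by taking a square root of the
      bound at the exponent \<open>n * 2\<close>.\<close>
    have *: "a [^] (n * 2) \<otimes> p \<preceq> b [^] (n * 2)" "b [^] (n * 2) \<otimes> p \<preceq> c [^] (n * 2)"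
      using ab bc unfolding arch_le_def by blast+
    have "(a [^] (n * 2) \<otimes> p) \<otimes> p \<preceq> b [^] (n * 2) \<otimes> p"
      using mem p * by (intro mult_right_mono) auto
    then have "(a [^] (n * 2) \<otimes> p) \<otimes> p \<preceq> c [^] (n * 2)"
      using * mem p by (blast intro: trans m_closed nat_pow_closed)
    moreover have "(a [^] n \<otimes> p) [^] (2::nat) = (a [^] (n * 2) \<otimes> p) \<otimes> p"
      using mem p by (simp add: mult_2_right nat_pow_mult[symmetric] numeral_2_eq_2 m_ac)
    moreover have "(c [^] n) [^] (2::nat) = c [^] (n * 2)"
      using mem by (simp add: nat_pow_pow)
    ultimately have "(a [^] n \<otimes> p) [^] (2::nat) \<preceq> (c [^] n) [^] (2::nat)"
      by (simp only:)
    then show ?thesis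
      by (rule pow_le_imp_le) (use mem p in simp_all)
  qed
  then show "arch_le p a c" by (simp add: arch_le_def)
next
  fix a b c assume ab: "arch_le p a b"
    and mem: "a \<in> carrier G" "b \<in> carrier G" "c \<in> carrier G"
  have "(a \<otimes> c) [^] n \<otimes> p \<preceq> (b \<otimes> c) [^] n" for n :: nat
  proof -
    have "(a [^] n \<otimes> p) \<otimes> c [^] n \<preceq> b [^] n \<otimes> c [^] n"
      using ab mem p unfolding arch_le_def by (intro mult_right_mono) auto
    moreover have "(a \<otimes> c) [^] n \<otimes> p = (a [^] n \<otimes> p) \<otimes> c [^] n"
      using mem p by (simp add: pow_mult_distrib m_comm m_ac)
    moreover have "(b \<otimes> c) [^] n = b [^] n \<otimes> c [^] n"
      using mem by (simp add: pow_mult_distrib m_comm)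
    ultimately show ?thesis by simp
  qed
  then show "arch_le p (a \<otimes> c) (b \<otimes> c)" by (simp add: arch_le_def)
qed

end

section \<open>Valuations as relations\<close>

text \<open>
  The relation \<open>|a| \<le> |b|\<close> of a valuation.  Points of an adic spectrum are such relations, and all
  comparisons between points take place at this level, where no value group has to be chosen.
\<close>

locale valuation_relation = cring A for A (structure) +
  fixes x :: "('a \<times> 'a) set"
  assumes rel_closed: "(a, b) \<in> x \<Longrightarrow> a \<in> carrier A \<and> b \<in> carrier A"
    and rel_total: "\<lbrakk>a \<in> carrier A; b \<in> carrier A\<rbrakk> \<Longrightarrow> (a, b) \<in> x \<or> (b, a) \<in> x"
    and rel_trans: "\<lbrakk>(a, b) \<in> x; (b, c) \<in> x\<rbrakk> \<Longrightarrow> (a, c) \<in> x"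
    and rel_zero: "a \<in> carrier A \<Longrightarrow> (\<zero>, a) \<in> x"
    and rel_one: "(\<one>, \<zero>) \<notin> x"
    and rel_mult: "\<lbrakk>(a, b) \<in> x; c \<in> carrier A\<rbrakk> \<Longrightarrow> (a \<otimes> c, b \<otimes> c) \<in> x"
    and rel_cancel: "\<lbrakk>(a \<otimes> c, b \<otimes> c) \<in> x; (c, \<zero>) \<notin> x; a \<in> carrier A; b \<in> carrier A; c \<in> carrier A\<rbrakk>
       \<Longrightarrow> (a, b) \<in> x"
    and rel_add: "\<lbrakk>(a, c) \<in> x; (b, c) \<in> x\<rbrakk> \<Longrightarrow> (a \<oplus> b, c) \<in> x"
begin

lemma rel_refl: "a \<in> carrier A \<Longrightarrow> (a, a) \<in> x"
  using rel_total by blast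

lemma rel_mult_mono:
  assumes "(a, b) \<in> x" "(c, d) \<in> x"
  shows "(a \<otimes> c, b \<otimes> d) \<in> x"
proof -
  have mem: "a \<in> carrier A" "b \<in> carrier A" "c \<in> carrier A" "d \<in> carrier A"
    using assms rel_closed by blast+
  have "(a \<otimes> c, b \<otimes> c) \<in> x" using rel_mult[OF assms(1) mem(3)] .
  moreover have "(b \<otimes> c, b \<otimes> d) \<in> x" using rel_mult[OF assms(2) mem(2)] mem by (simp add: m_comm)
  ultimately show ?thesis by (rule rel_trans)
qed

lemma rel_pow_mono: "(a, b) \<in> x \<Longrightarrow> (a [^] (n::nat), b [^] n) \<in> x"
  by (induction n) (auto intro: rel_refl rel_mult_mono)

end

locale valued_ring = A: cring A + G: ordered_comm_group G leq
  for A :: "('a, 'k) ring_scheme" and G :: "('g, 'm) monoid_scheme" and leq +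
  fixes v
  assumes val: "valuation A G leq v"
begin

lemma v_zero: "v \<zero>\<^bsub>A\<^esub> = None"
  and v_one: "v \<one>\<^bsub>A\<^esub> = Some \<one>\<^bsub>G\<^esub>"
  and v_mult: "\<lbrakk>a \<in> carrier A; b \<in> carrier A\<rbrakk> \<Longrightarrow> v (a \<otimes>\<^bsub>A\<^esub> b) = val_mult G (v a) (v b)"
  and v_add: "\<lbrakk>a \<in> carrier A; b \<in> carrier A\<rbrakk> \<Longrightarrow>
    val_le leq (v (a \<oplus>\<^bsub>A\<^esub> b)) (v a) \<or> val_le leq (v (a \<oplus>\<^bsub>A\<^esub> b)) (v b)"
  and v_range: "a \<in> carrier A \<Longrightarrow> v a \<in> insert None (Some ` carrier G)"
  using val unfolding valuation_def by auto

lemma v_Some_closed: "\<lbrakk>a \<in> carrier A; v a = Some g\<rbrakk> \<Longrightarrow> g \<in> carrier G"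
  using v_range[of a] by auto

lemma v_pow_Some:
  "\<lbrakk>a \<in> carrier A; v a = Some g\<rbrakk> \<Longrightarrow> v (a [^]\<^bsub>A\<^esub> (n::nat)) = Some (g [^]\<^bsub>G\<^esub> n)"
  by (induction n) (auto simp: v_one v_mult)

lemma v_pow_None:
  "\<lbrakk>a \<in> carrier A; v a = None\<rbrakk> \<Longrightarrow> v (a [^]\<^bsub>A\<^esub> (n::nat)) = (if n = 0 then Some \<one>\<^bsub>G\<^esub> else None)"
  by (cases n) (auto simp: v_one v_mult split: option.split, metis val_mult.simps(3) option.exhaust val_mult.simps(2))

lemma val_le_trans:
  assumes "val_le leq p q" "val_le leq q r"
    and "p \<in> insert None (Some ` carrier G)" "q \<in> insert None (Some ` carrier G)"
      "r \<in> insert None (Some ` carrier G)"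
  shows "val_le leq p r"
  using assms by (cases p; cases q; cases r) (auto intro: G.trans)

lemma valuation_relation_class: "valuation_relation A (valuation_class A leq v)"
proof
  fix a b c
  show "(a, b) \<in> valuation_class A leq v \<Longrightarrow> a \<in> carrier A \<and> b \<in> carrier A"
    by (simp add: valuation_class_def)
  show "(a, b) \<in> valuation_class A leq v \<or> (b, a) \<in> valuation_class A leq v"
    if "a \<in> carrier A" "b \<in> carrier A"
    using that v_range[OF that(1)] v_range[OF that(2)] G.total[of "the (v a)" "the (v b)"]
    by (auto simp: valuation_class_def)
  show "(a, c) \<in> valuation_class A leq v"
    if "(a, b) \<in> valuation_class A leq v" "(b, c) \<in> valuation_class A leq v"
    using that val_le_trans[OF _ _ v_range v_range v_range, of a b c] unfolding valuation_class_def by simp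
  show "a \<in> carrier A \<Longrightarrow> (\<zero>\<^bsub>A\<^esub>, a) \<in> valuation_class A leq v"
    by (simp add: valuation_class_def v_zero)
  show "(\<one>\<^bsub>A\<^esub>, \<zero>\<^bsub>A\<^esub>) \<notin> valuation_class A leq v"
    by (simp add: valuation_class_def v_zero v_one)
  show "(a \<otimes>\<^bsub>A\<^esub> c, b \<otimes>\<^bsub>A\<^esub> c) \<in> valuation_class A leq v"
    if "(a, b) \<in> valuation_class A leq v" "c \<in> carrier A"
    using that v_range[of a] v_range[of b] v_range[of c] G.mult_right_mono[of "the (v a)" "the (v b)" "the (v c)"]
    by (auto simp: valuation_class_def v_mult)
  show "(a, b) \<in> valuation_class A leq v"
    if "(a \<otimes>\<^bsub>A\<^esub> c, b \<otimes>\<^bsub>A\<^esub> c) \<in> valuation_class A leq v" "(c, \<zero>\<^bsub>A\<^esub>) \<notin> valuation_class A leq v"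
      "a \<in> carrier A" "b \<in> carrier A" "c \<in> carrier A"
    using that v_range[of a] v_range[of b] v_range[of c] G.mult_right_cancel[of "the (v a)" "the (v c)" "the (v b)"]
    by (auto simp: valuation_class_def v_mult v_zero)
  show "(a \<oplus>\<^bsub>A\<^esub> b, c) \<in> valuation_class A leq v"
    if "(a, c) \<in> valuation_class A leq v" "(b, c) \<in> valuation_class A leq v"
  proof -
    have mem: "a \<in> carrier A" "b \<in> carrier A" "c \<in> carrier A"
      using that by (auto simp: valuation_class_def)
    then have "val_le leq (v (a \<oplus>\<^bsub>A\<^esub> b)) (v c)"
      using v_add[OF mem(1,2)] that val_le_trans[OF _ _ v_range v_range v_range, of "a \<oplus>\<^bsub>A\<^esub> b" a c]
        val_le_trans[OF _ _ v_range v_range v_range, of "a \<oplus>\<^bsub>A\<^esub> b" b c]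
      unfolding valuation_class_def by auto
    then show ?thesis
      using mem unfolding valuation_class_def by simp
  qed
qed

end

lemma valued_ringI:
  assumes "cring A" "valuation A G leq v"
  shows "valued_ring A G leq v"
  using assms unfolding valued_ring_def valued_ring_axioms_def
  by (auto simp: valuation_def ordered_abelian_group_iff)

section \<open>Continuous valuations on an adic ring with inverted uniformizer\<close>

text \<open>
  The model is the canonical map \<open>h\<close> from \<open>R\<close> to \<open>A = R[1/w]\<close>, with the images of the ideals
  \<open>w\<^sup>nR\<close> as basic neighbourhoods of zero.
\<close>

locale adic_pair = R: cring R + A: cring A
  for R :: "('r, 'k) ring_scheme" and A :: "('a, 'l) ring_scheme" +
  fixes h :: "'r \<Rightarrow> 'a" and w :: 'r
  assumes hom: "h \<in> ring_hom R A"
    and w_closed [simp]: "w \<in> carrier R"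
    and hw_unit: "h w \<in> Units A"
begin

lemma h_closed [simp]: "r \<in> carrier R \<Longrightarrow> h r \<in> carrier A"
  using hom by (rule ring_hom_closed)

lemma h_mult: "\<lbrakk>r \<in> carrier R; s \<in> carrier R\<rbrakk> \<Longrightarrow> h (r \<otimes>\<^bsub>R\<^esub> s) = h r \<otimes>\<^bsub>A\<^esub> h s"
  and h_add: "\<lbrakk>r \<in> carrier R; s \<in> carrier R\<rbrakk> \<Longrightarrow> h (r \<oplus>\<^bsub>R\<^esub> s) = h r \<oplus>\<^bsub>A\<^esub> h s"
  and h_one: "h \<one>\<^bsub>R\<^esub> = \<one>\<^bsub>A\<^esub>"
  using hom by (auto simp: ring_hom_mult ring_hom_add ring_hom_one)

lemma h_zero: "h \<zero>\<^bsub>R\<^esub> = \<zero>\<^bsub>A\<^esub>"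
  using ring_hom_zero[OF hom R.ring_axioms A.ring_axioms] .

lemma h_pow: "r \<in> carrier R \<Longrightarrow> h (r [^]\<^bsub>R\<^esub> (n::nat)) = h r [^]\<^bsub>A\<^esub> n"
  by (induction n) (auto simp: h_one h_mult)

definition basic_nhd :: "nat \<Rightarrow> 'a set" where
  "basic_nhd n = h ` (PIdl\<^bsub>R\<^esub> (w [^]\<^bsub>R\<^esub> n))"

definition ring_topology :: "'a topology" where
  "ring_topology = topology_generated_by {basic_nhd n +>\<^bsub>A\<^esub> u | n u. u \<in> carrier A}"

lemma basic_nhd_iff: "q \<in> basic_nhd n \<longleftrightarrow> (\<exists>r\<in>carrier R. q = h (r \<otimes>\<^bsub>R\<^esub> w [^]\<^bsub>R\<^esub> n))"
  by (auto simp: basic_nhd_def cgenideal_def)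

lemma basic_nhd_closed: "q \<in> basic_nhd n \<Longrightarrow> q \<in> carrier A"
  by (auto simp: basic_nhd_iff)

lemma basic_nhd_zero: "\<zero>\<^bsub>A\<^esub> \<in> basic_nhd n"
  unfolding basic_nhd_iff by (rule bexI[of _ "\<zero>\<^bsub>R\<^esub>"]) (auto simp: h_zero)

lemma basic_nhd_add: "\<lbrakk>p \<in> basic_nhd n; q \<in> basic_nhd n\<rbrakk> \<Longrightarrow> p \<oplus>\<^bsub>A\<^esub> q \<in> basic_nhd n"
  unfolding basic_nhd_iff
proof (elim bexE)
  fix r s assume rs: "r \<in> carrier R" "s \<in> carrier R"
    and pq: "p = h (r \<otimes>\<^bsub>R\<^esub> w [^]\<^bsub>R\<^esub> n)" "q = h (s \<otimes>\<^bsub>R\<^esub> w [^]\<^bsub>R\<^esub> n)"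
  show "\<exists>r\<in>carrier R. p \<oplus>\<^bsub>A\<^esub> q = h (r \<otimes>\<^bsub>R\<^esub> w [^]\<^bsub>R\<^esub> n)"
    by (rule bexI[of _ "r \<oplus>\<^bsub>R\<^esub> s"]) (use rs pq in \<open>simp_all add: h_add[symmetric] R.l_distr\<close>)
qed

lemma basic_nhd_antimono: "m \<le> n \<Longrightarrow> basic_nhd n \<subseteq> basic_nhd m"
proof
  fix q assume "m \<le> n" "q \<in> basic_nhd n"
  then obtain r where r: "r \<in> carrier R" "q = h (r \<otimes>\<^bsub>R\<^esub> w [^]\<^bsub>R\<^esub> n)"
    unfolding basic_nhd_iff by blast
  have "w [^]\<^bsub>R\<^esub> n = w [^]\<^bsub>R\<^esub> (n - m) \<otimes>\<^bsub>R\<^esub> w [^]\<^bsub>R\<^esub> m"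
    using \<open>m \<le> n\<close> by (simp add: R.nat_pow_mult)
  with r(1) have "r \<otimes>\<^bsub>R\<^esub> w [^]\<^bsub>R\<^esub> n = (r \<otimes>\<^bsub>R\<^esub> w [^]\<^bsub>R\<^esub> (n - m)) \<otimes>\<^bsub>R\<^esub> w [^]\<^bsub>R\<^esub> m"
    by (simp add: R.m_assoc)
  then show "q \<in> basic_nhd m"
    unfolding basic_nhd_iff r(2) using r(1)
    by (intro bexI[of _ "r \<otimes>\<^bsub>R\<^esub> w [^]\<^bsub>R\<^esub> (n - m)"]) simp_all
qed

lemma openin_ring_topology:
  "openin ring_topology U \<longleftrightarrow>
     U \<subseteq> carrier A \<and> (\<forall>z\<in>U. \<exists>n. \<forall>q\<in>basic_nhd n. q \<oplus>\<^bsub>A\<^esub> z \<in> U)" (is "?l \<longleftrightarrow> ?r")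
proof
  assume ?l
  then have "generate_topology_on {basic_nhd n +>\<^bsub>A\<^esub> u | n u. u \<in> carrier A} U"
    unfolding ring_topology_def by (rule openin_topology_generated_by)
  then show ?r
  proof induction
    case (Int U W)
    have "\<exists>n. \<forall>q\<in>basic_nhd n. q \<oplus>\<^bsub>A\<^esub> z \<in> U \<inter> W" if "z \<in> U \<inter> W" for z
    proof -
      obtain m n where m: "\<forall>q\<in>basic_nhd m. q \<oplus>\<^bsub>A\<^esub> z \<in> U" and n: "\<forall>q\<in>basic_nhd n. q \<oplus>\<^bsub>A\<^esub> z \<in> W"
        using Int.IH \<open>z \<in> U \<inter> W\<close> by blast
      have "basic_nhd (max m n) \<subseteq> basic_nhd m" "basic_nhd (max m n) \<subseteq> basic_nhd n"
        by (simp_all add: basic_nhd_antimono)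
      then show ?thesis using m n by (intro exI[of _ "max m n"]) blast
    qed
    then show ?case using Int.IH by blast
  next
    case (UN K)
    have "\<exists>n. \<forall>q\<in>basic_nhd n. q \<oplus>\<^bsub>A\<^esub> z \<in> \<Union>K" if "k \<in> K" "z \<in> k" for z k
      using UN.IH[OF that(1)] that by blast
    then show ?case using UN.IH by blast
  next
    case (Basis s)
    then obtain n u where u: "u \<in> carrier A" and s: "s = basic_nhd n +>\<^bsub>A\<^esub> u" by blast
    have elem: "z \<in> s \<longleftrightarrow> (\<exists>q\<in>basic_nhd n. z = q \<oplus>\<^bsub>A\<^esub> u)" for z
      by (auto simp: s a_r_coset_def')
    have "q \<oplus>\<^bsub>A\<^esub> z \<in> s" if z: "z \<in> s" and q: "q \<in> basic_nhd n" for z q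
    proof -
      obtain p where p: "p \<in> basic_nhd n" "z = p \<oplus>\<^bsub>A\<^esub> u" using z elem by blast
      have "q \<oplus>\<^bsub>A\<^esub> z = (q \<oplus>\<^bsub>A\<^esub> p) \<oplus>\<^bsub>A\<^esub> u"
        using p q u basic_nhd_closed by (simp add: A.a_assoc)
      then show ?thesis using basic_nhd_add[OF q p(1)] elem by blast
    qed
    moreover have "s \<subseteq> carrier A"
      using elem u basic_nhd_closed by auto
    ultimately show ?case by blast
  qed simp
next
  assume r: ?r
  have "\<exists>W. openin ring_topology W \<and> z \<in> W \<and> W \<subseteq> U" if z: "z \<in> U" for z
  proof -
    have zc: "z \<in> carrier A" using z r by blast
    obtain n where n: "\<forall>q\<in>basic_nhd n. q \<oplus>\<^bsub>A\<^esub> z \<in> U" using z r by blast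
    have "openin ring_topology (basic_nhd n +>\<^bsub>A\<^esub> z)"
      unfolding ring_topology_def using zc by (intro topology_generated_by_Basis) blast
    moreover have "z \<in> basic_nhd n +>\<^bsub>A\<^esub> z"
      using basic_nhd_zero[of n] zc unfolding a_r_coset_def' by force
    moreover have "basic_nhd n +>\<^bsub>A\<^esub> z \<subseteq> U"
      using n by (auto simp: a_r_coset_def')
    ultimately show ?thesis by blast
  qed
  then show ?l by (subst openin_subopen) blast
qed

text \<open>Continuity only concerns neighbourhoods of zero, because strict balls are subgroups.\<close>

lemma continuous_valuation_iff:
  "continuous_valuation A ring_topology G leq v \<longleftrightarrow> valuation A G leq v \<and>
     (\<forall>g\<in>value_group A G v. \<exists>n. \<forall>q\<in>basic_nhd n. val_le leq (v q) (Some g) \<and> v q \<noteq> Some g)"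
  (is "?l \<longleftrightarrow> ?v \<and> ?r")
proof (cases ?v)
  case True
  interpret valued_ring A G leq v by (rule valued_ringI[OF A.cring_axioms True])
  have vg: "g \<in> carrier G" if "g \<in> value_group A G v" for g
    using that G.generate_in_carrier[of "{g. Some g \<in> v ` carrier A}" g] v_range
    unfolding value_group_def by force
  have "openin ring_topology {a \<in> carrier A. val_le leq (v a) (Some g) \<and> v a \<noteq> Some g} \<longleftrightarrow>
      (\<exists>n. \<forall>q\<in>basic_nhd n. val_le leq (v q) (Some g) \<and> v q \<noteq> Some g)"
    if g: "g \<in> value_group A G v" for g
  proof
    assume "openin ring_topology {a \<in> carrier A. val_le leq (v a) (Some g) \<and> v a \<noteq> Some g}"
    moreover have "\<zero>\<^bsub>A\<^esub> \<in> {a \<in> carrier A. val_le leq (v a) (Some g) \<and> v a \<noteq> Some g}"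
      by (simp add: v_zero)
    ultimately obtain n where n: "\<forall>q\<in>basic_nhd n. q \<oplus>\<^bsub>A\<^esub> \<zero>\<^bsub>A\<^esub> \<in>
        {a \<in> carrier A. val_le leq (v a) (Some g) \<and> v a \<noteq> Some g}"
      unfolding openin_ring_topology by blast
    then show "\<exists>n. \<forall>q\<in>basic_nhd n. val_le leq (v q) (Some g) \<and> v q \<noteq> Some g"
      using basic_nhd_closed by (intro exI[of _ n]) auto
  next
    assume "\<exists>n. \<forall>q\<in>basic_nhd n. val_le leq (v q) (Some g) \<and> v q \<noteq> Some g"
    then obtain n where n: "\<And>q. q \<in> basic_nhd n \<Longrightarrow> val_le leq (v q) (Some g) \<and> v q \<noteq> Some g"
      by blast
    have lt: "val_le leq (v c) (Some g) \<and> v c \<noteq> Some g"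
      if "val_le leq (v c) (v d)" "val_le leq (v d) (Some g) \<and> v d \<noteq> Some g"
        "c \<in> carrier A" "d \<in> carrier A" for c d
    proof -
      have "val_le leq (v c) (Some g)"
        using that vg[OF g] val_le_trans[OF that(1) _ v_range v_range] by blast
      moreover have "v c \<noteq> Some g"
      proof
        assume "v c = Some g"
        then show False
          using that v_Some_closed[OF that(4)] vg[OF g] G.antisym[of "the (v d)" g] by (cases "v d") auto
      qed
      ultimately show ?thesis ..
    qed
    have "val_le leq (v (q \<oplus>\<^bsub>A\<^esub> z)) (Some g) \<and> v (q \<oplus>\<^bsub>A\<^esub> z) \<noteq> Some g"
      if q: "q \<in> basic_nhd n" and z: "z \<in> carrier A" "val_le leq (v z) (Some g) \<and> v z \<noteq> Some g" for q z
      using v_add[OF basic_nhd_closed[OF q] z(1)] lt[OF _ n[OF q]] lt[OF _ z(2)] z(1)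
        basic_nhd_closed[OF q] by blast
    then show "openin ring_topology {a \<in> carrier A. val_le leq (v a) (Some g) \<and> v a \<noteq> Some g}"
      unfolding openin_ring_topology using basic_nhd_closed by blast
  qed
  with True show ?thesis unfolding continuous_valuation_def by blast
qed (simp add: continuous_valuation_def)

definition points :: "('a \<times> 'a) set set" where
  "points = Spa_points A ring_topology (h ` carrier R)"

lemma point_valuation:
  assumes "x \<in> points"
  obtains G :: "('a \<times> 'a) set monoid" and leq v where "x = valuation_class A leq v"
    "valued_ring A G leq v"
    "\<And>g. g \<in> value_group A G v \<Longrightarrow>
       \<exists>n. \<forall>q\<in>basic_nhd n. val_le leq (v q) (Some g) \<and> v q \<noteq> Some g"
    "\<And>r. r \<in> carrier R \<Longrightarrow> val_le leq (v (h r)) (Some \<one>\<^bsub>G\<^esub>)"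
proof -
  from assms obtain G :: "('a \<times> 'a) set monoid" and leq v where x: "x = valuation_class A leq v"
    and c: "continuous_valuation A ring_topology G leq v"
    and b: "\<forall>a\<in>h ` carrier R. val_le leq (v a) (Some \<one>\<^bsub>G\<^esub>)"
    unfolding points_def Spa_points_def by blast
  show ?thesis
  proof (rule that[OF x])
    show "valued_ring A G leq v"
      using c by (intro valued_ringI A.cring_axioms) (simp add: continuous_valuation_def)
    show "\<exists>n. \<forall>q\<in>basic_nhd n. val_le leq (v q) (Some g) \<and> v q \<noteq> Some g"
      if "g \<in> value_group A G v" for g
      using c that unfolding continuous_valuation_iff by blast
    show "val_le leq (v (h r)) (Some \<one>\<^bsub>G\<^esub>)" if "r \<in> carrier R" for r
      using b that by blast
  qed
qed

lemma point_valuation_relation: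
  assumes "x \<in> points"
  shows "valuation_relation A x"
  using assms by (metis point_valuation valued_ring.valuation_relation_class)

lemma point_bounded:
  assumes "x \<in> points" "r \<in> carrier R"
  shows "(h r, \<one>\<^bsub>A\<^esub>) \<in> x"
proof -
  obtain G :: "('a \<times> 'a) set monoid" and leq v where x: "x = valuation_class A leq v"
    and "valued_ring A G leq v"
    and b: "\<And>r. r \<in> carrier R \<Longrightarrow> val_le leq (v (h r)) (Some \<one>\<^bsub>G\<^esub>)"
    using point_valuation[OF assms(1)] by blast
  then interpret valued_ring A G leq v by simp
  show ?thesis using b[OF assms(2)] assms(2) by (simp add: x valuation_class_def v_one)
qed

text \<open>
  The elements whose value is less than that of \<open>a\<close> form an open set around zero, and the powers of
  \<open>w\<close> tend to zero.
\<close>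

lemma point_continuous:
  assumes "x \<in> points" "a \<in> carrier A" "(a, \<zero>\<^bsub>A\<^esub>) \<notin> x"
  obtains n :: nat where "(a, h w [^]\<^bsub>A\<^esub> n) \<notin> x"
proof -
  obtain G :: "('a \<times> 'a) set monoid" and leq v where x: "x = valuation_class A leq v"
    and "valued_ring A G leq v"
    and c: "\<And>g. g \<in> value_group A G v \<Longrightarrow>
       \<exists>n. \<forall>q\<in>basic_nhd n. val_le leq (v q) (Some g) \<and> v q \<noteq> Some g"
    using point_valuation[OF assms(1)] by blast
  then interpret valued_ring A G leq v by simp
  obtain g where g: "v a = Some g"
    using assms by (cases "v a") (auto simp: x valuation_class_def v_zero)
  have gc: "g \<in> carrier G" using v_Some_closed[OF assms(2) g] .
  have "g \<in> value_group A G v"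
    unfolding value_group_def using g assms(2) by (intro generate.incl) force
  then obtain n where n: "\<And>q. q \<in> basic_nhd n \<Longrightarrow> val_le leq (v q) (Some g) \<and> v q \<noteq> Some g"
    using c by blast
  have hwn: "h w [^]\<^bsub>A\<^esub> n \<in> basic_nhd n"
    unfolding basic_nhd_iff by (rule bexI[of _ "\<one>\<^bsub>R\<^esub>"]) (simp_all add: h_pow)
  have "\<not> val_le leq (Some g) (v (h w [^]\<^bsub>A\<^esub> n))"
    using n[OF hwn] G.antisym[of _ g] gc v_Some_closed[of "h w [^]\<^bsub>A\<^esub> n"]
    by (cases "v (h w [^]\<^bsub>A\<^esub> n)") auto
  then have "(a, h w [^]\<^bsub>A\<^esub> n) \<notin> x"
    by (simp add: x valuation_class_def g)
  then show ?thesis by (rule that)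
qed

lemma point_hw_nonzero:
  assumes "x \<in> points"
  shows "(h w, \<zero>\<^bsub>A\<^esub>) \<notin> x"
proof
  interpret valuation_relation A x by (rule point_valuation_relation[OF assms])
  assume "(h w, \<zero>\<^bsub>A\<^esub>) \<in> x"
  then have "(h w \<otimes>\<^bsub>A\<^esub> inv\<^bsub>A\<^esub> (h w), \<zero>\<^bsub>A\<^esub> \<otimes>\<^bsub>A\<^esub> inv\<^bsub>A\<^esub> (h w)) \<in> x"
    using hw_unit by (intro rel_mult) auto
  then show False using hw_unit rel_one by simp
qed

lemma point_hw_less_one:
  assumes "x \<in> points"
  shows "(\<one>\<^bsub>A\<^esub>, h w) \<notin> x"
proof
  interpret valuation_relation A x by (rule point_valuation_relation[OF assms])
  assume one: "(\<one>\<^bsub>A\<^esub>, h w) \<in> x"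
  obtain n :: nat where "(\<one>\<^bsub>A\<^esub>, h w [^]\<^bsub>A\<^esub> n) \<notin> x"
    using point_continuous[OF assms A.one_closed rel_one] by blast
  then show False using rel_pow_mono[OF one, of n] by simp
qed

section \<open>The maximal generalization\<close>

text \<open>
  At a rank-one point \<open>a\<close> is bounded by \<open>b\<close> as soon as all powers of \<open>a/b\<close> stay below one fixed
  bound.  Imposing this with the bound \<open>1/w\<close> turns an arbitrary continuous valuation into the
  valuation modulo the largest convex subgroup that does not contain the value of \<open>w\<close>.
\<close>

definition max_gen :: "('a \<times> 'a) set \<Rightarrow> ('a \<times> 'a) set" where
  "max_gen x = {(a, b). a \<in> carrier A \<and> b \<in> carrier A \<and>
     (\<forall>n::nat. (a [^]\<^bsub>A\<^esub> n \<otimes>\<^bsub>A\<^esub> h w, b [^]\<^bsub>A\<^esub> n) \<in> x)}"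

end

context adic_pair
begin

text \<open>
  For the value \<open>p\<close> of \<open>w\<close>, the quotient by the infinitesimal elements has exactly \<open>max_gen\<close> as its
  relation: the condition that defines \<open>arch_le\<close> is evaluated at values of \<open>a\<close> and \<open>b\<close>.
\<close>

lemma max_gen_valuation_class:
  assumes "valued_ring A G leq v" "v (h w) = Some p" "p \<in> carrier G" "leq p \<one>\<^bsub>G\<^esub>"
  shows "valuation_class A (ordered_comm_group.arch_le G leq p)
      (\<lambda>a. map_option (ordered_comm_group.coarse_rep G (ordered_comm_group.arch_le G leq p)) (v a))
    = max_gen (valuation_class A leq v)" (is "valuation_class A ?le ?v = _")
proof -
  interpret valued_ring A G leq v by (rule assms(1))
  interpret C: coarser_order G leq ?le by (rule G.arch_le_coarser[OF assms(3,4)])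
  have "val_le ?le (?v a) (?v b) \<longleftrightarrow>
      (\<forall>n::nat. val_le leq (v (a [^]\<^bsub>A\<^esub> n \<otimes>\<^bsub>A\<^esub> h w)) (v (b [^]\<^bsub>A\<^esub> n)))"
    if ab: "a \<in> carrier A" "b \<in> carrier A" for a b
  proof -
    have vm: "v (a [^]\<^bsub>A\<^esub> n \<otimes>\<^bsub>A\<^esub> h w) = val_mult G (v (a [^]\<^bsub>A\<^esub> n)) (Some p)" for n :: nat
      using ab by (simp add: v_mult assms(2))
    consider "v a = None" | g where "v a = Some g" "v b = None"
      | g k where "v a = Some g" "v b = Some k"
      by (cases "v a"; cases "v b") auto
    then show ?thesis
    proof cases
      case 1
      have "val_le leq (val_mult G (v (a [^]\<^bsub>A\<^esub> n)) (Some p)) (v (b [^]\<^bsub>A\<^esub> n))" for n :: nat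
        by (cases "n = 0") (use 1 ab assms(3,4) in \<open>simp_all add: v_pow_None v_one\<close>)
      then show ?thesis using 1 by (simp add: vm)
    next
      case 2
      have "\<not> val_le leq (val_mult G (v (a [^]\<^bsub>A\<^esub> (1::nat))) (Some p)) (v (b [^]\<^bsub>A\<^esub> (1::nat)))"
        using 2 ab by simp
      then have "\<not> (\<forall>n::nat. val_le leq (val_mult G (v (a [^]\<^bsub>A\<^esub> n)) (Some p)) (v (b [^]\<^bsub>A\<^esub> n)))"
        by blast
      moreover have "\<not> val_le ?le (?v a) (?v b)" using 2 by simp
      ultimately show ?thesis unfolding vm by blast
    next
      case 3
      have gk: "g \<in> carrier G" "k \<in> carrier G"
        using 3 ab v_Some_closed by blast+
      have "?le (C.rep g) (C.rep k) \<longleftrightarrow> (\<forall>n::nat. leq (g [^]\<^bsub>G\<^esub> n \<otimes>\<^bsub>G\<^esub> p) (k [^]\<^bsub>G\<^esub> n))"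
        by (rule HOL.trans[OF C.ple_rep_iff[OF gk] G.arch_le_def])
      then show ?thesis
        unfolding vm using 3 ab by (simp add: v_pow_Some)
    qed
  qed
  then show ?thesis
    unfolding valuation_class_def max_gen_def by auto
qed

lemma coarse_valuation:
  assumes "valued_ring A G leq v" "coarser_order G leq ple"
  shows "valuation A (ordered_comm_group.coarse_group G ple) ple
     (\<lambda>a. map_option (ordered_comm_group.coarse_rep G ple) (v a))" (is "valuation A ?Q ple ?v")
proof -
  interpret valued_ring A G leq v by (rule assms(1))
  interpret C: coarser_order G leq ple by (rule assms(2))
  have mono: "val_le ple (map_option C.rep y) (map_option C.rep z)"
    if "val_le leq y z" "y \<in> insert None (Some ` carrier G)" "z \<in> insert None (Some ` carrier G)" for y z
    using that by (cases y; cases z) (auto simp: C.ple_rep_iff C.ple_coarser)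
  have mult: "map_option C.rep (val_mult G y z) = val_mult ?Q (map_option C.rep y) (map_option C.rep z)"
    if "y \<in> insert None (Some ` carrier G)" "z \<in> insert None (Some ` carrier G)" for y z
    using that by (cases y; cases z) (auto simp: C.mult_coarse_group)
  show ?thesis
    unfolding valuation_def
  proof (intro conjI ballI)
    show "ordered_abelian_group ?Q ple" by (rule C.ordered_abelian_group_coarse_group)
    show "?v \<in> carrier A \<rightarrow> insert None (Some ` carrier ?Q)"
      unfolding C.carrier_coarse_group using v_range by (fastforce)
    show "?v \<zero>\<^bsub>A\<^esub> = None" "?v \<one>\<^bsub>A\<^esub> = Some \<one>\<^bsub>?Q\<^esub>"
      by (simp_all add: v_zero v_one C.one_coarse_group)
    fix a b assume ab: "a \<in> carrier A" "b \<in> carrier A"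
    show "?v (a \<otimes>\<^bsub>A\<^esub> b) = val_mult ?Q (?v a) (?v b)"
      using mult[OF v_range[OF ab(1)] v_range[OF ab(2)]] ab by (simp add: v_mult)
    show "val_le ple (?v (a \<oplus>\<^bsub>A\<^esub> b)) (?v a) \<or> val_le ple (?v (a \<oplus>\<^bsub>A\<^esub> b)) (?v b)"
      using v_add[OF ab] mono[OF _ v_range[OF A.a_closed[OF ab]]] v_range ab by blast
  qed
qed

text \<open>
  Since \<open>max_gen\<close> is defined by comparing powers, the valuation axioms are not visible from its
  definition; they hold because it is the relation of a quotient valuation.
\<close>

lemma max_gen_point:
  assumes "x \<in> points"
  shows "max_gen x \<in> points"
proof -
  obtain G :: "('a \<times> 'a) set monoid" and leq v where x: "x = valuation_class A leq v"
    and vr: "valued_ring A G leq v"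
    and c: "\<And>g. g \<in> value_group A G v \<Longrightarrow>
       \<exists>n. \<forall>q\<in>basic_nhd n. val_le leq (v q) (Some g) \<and> v q \<noteq> Some g"
    and b: "\<And>r. r \<in> carrier R \<Longrightarrow> val_le leq (v (h r)) (Some \<one>\<^bsub>G\<^esub>)"
    using point_valuation[OF assms] by blast
  interpret valued_ring A G leq v by (rule vr)
  obtain p where vp: "v (h w) = Some p"
    using point_hw_nonzero[OF assms] by (cases "v (h w)") (auto simp: x valuation_class_def v_zero)
  have p: "p \<in> carrier G" using v_Some_closed[OF _ vp] by simp
  have p1: "leq p \<one>\<^bsub>G\<^esub>" using b[of w] vp by simp
  have p2: "\<not> leq \<one>\<^bsub>G\<^esub> p"
    using point_hw_less_one[OF assms] vp by (simp add: x valuation_class_def v_one)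
  let ?le = "G.arch_le p"
  interpret C: coarser_order G leq ?le by (rule G.arch_le_coarser[OF p p1])
  let ?v = "\<lambda>a. map_option C.rep (v a)"
  have eq: "max_gen x = valuation_class A ?le ?v"
    unfolding x by (rule max_gen_valuation_class[OF vr vp p p1, symmetric])
  have vQ: "valuation A C.Q ?le ?v"
    by (rule coarse_valuation[OF vr C.coarser_order_axioms])
  have "\<exists>n. \<forall>q\<in>basic_nhd n. val_le ?le (?v q) (Some g) \<and> ?v q \<noteq> Some g"
    if "g \<in> value_group A C.Q ?v" for g
  proof -
    have sub: "{d. Some d \<in> v ` carrier A} \<subseteq> carrier G"
      using v_Some_closed by force
    have "{d. Some d \<in> ?v ` carrier A} = C.rep ` {d. Some d \<in> v ` carrier A}"
    proof (intro subset_antisym subsetI; elim CollectE imageE)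
      fix d a assume "Some d = ?v a" "a \<in> carrier A"
      then show "d \<in> C.rep ` {d. Some d \<in> v ` carrier A}"
        by (cases "v a") (auto intro!: imageI intro: rev_image_eqI)
    next
      fix d k a assume d: "d = C.rep k" and k: "Some k = v a" and a: "a \<in> carrier A"
      show "d \<in> {d. Some d \<in> ?v ` carrier A}"
        by (auto intro!: rev_image_eqI[OF a] simp: d k[symmetric])
    qed
    then have "value_group A C.Q ?v = C.rep ` value_group A G v"
      unfolding value_group_def using group_hom.generate_img[OF C.rep_group_hom sub] by simp
    with that obtain k where k: "k \<in> value_group A G v" and g: "g = C.rep k"
      by blast
    have kc: "k \<in> carrier G"
      using k G.generate_in_carrier[OF sub] unfolding value_group_def by blast
    from c[OF k] obtain n where
      "\<forall>q\<in>basic_nhd n. val_le leq (v q) (Some k) \<and> v q \<noteq> Some k" by (rule exE)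
    then have n: "val_le leq (v q) (Some k)" if "q \<in> basic_nhd n" for q
      using that by simp
    \<comment> \<open>A value below \<open>k\<close> might become equal to it in the quotient; one more factor \<open>w\<close> separates
      the two, since \<open>p\<close> is not infinitesimally close to the unit.\<close>
    have "val_le ?le (?v q) (Some g) \<and> ?v q \<noteq> Some g" if q: "q \<in> basic_nhd (Suc n)" for q
    proof -
      obtain r where r: "r \<in> carrier R" and qr: "q = h (r \<otimes>\<^bsub>R\<^esub> w [^]\<^bsub>R\<^esub> Suc n)"
        using q basic_nhd_iff by blast
      let ?q = "h (r \<otimes>\<^bsub>R\<^esub> w [^]\<^bsub>R\<^esub> n)"
      have q': "?q \<in> basic_nhd n" using r basic_nhd_iff by blast
      have "q = ?q \<otimes>\<^bsub>A\<^esub> h w"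
        using r by (simp add: qr h_mult[symmetric] R.m_assoc)
      then have vq: "v q = val_mult G (v ?q) (Some p)"
        using r by (simp add: v_mult vp)
      show ?thesis
      proof (cases "v ?q")
        case None
        then show ?thesis by (simp add: vq)
      next
        case (Some d)
        have d: "d \<in> carrier G" using v_Some_closed[OF _ Some] r by simp
        have dk: "leq d k" using n[OF q'] Some by simp
        have le: "leq (d \<otimes>\<^bsub>G\<^esub> p) (k \<otimes>\<^bsub>G\<^esub> p)"
          using dk d kc p by (intro G.mult_right_mono)
        have le': "leq (k \<otimes>\<^bsub>G\<^esub> p) k"
          using G.mult_mono[OF G.refl[OF kc] p1] kc p by simp
        have "?le (d \<otimes>\<^bsub>G\<^esub> p) k"
          using G.trans[OF le le'] d kc p by (intro C.ple_coarser) simp_all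
        moreover have "C.rep (d \<otimes>\<^bsub>G\<^esub> p) \<noteq> C.rep k"
        proof
          assume "C.rep (d \<otimes>\<^bsub>G\<^esub> p) = C.rep k"
          then have "?le k (d \<otimes>\<^bsub>G\<^esub> p)"
            using C.ple_rep_iff[of k "d \<otimes>\<^bsub>G\<^esub> p"] C.ple_rep_iff[of k k] C.ple_coarser[OF G.refl] d kc p
            by simp
          then have "?le k (k \<otimes>\<^bsub>G\<^esub> p)"
            using C.ple_trans[OF _ C.ple_coarser[OF le]] d kc p by simp
          then have "leq (k [^]\<^bsub>G\<^esub> (2::nat) \<otimes>\<^bsub>G\<^esub> p) ((k \<otimes>\<^bsub>G\<^esub> p) [^]\<^bsub>G\<^esub> (2::nat))"
            unfolding G.arch_le_def by blast
          moreover have "k [^]\<^bsub>G\<^esub> (2::nat) \<otimes>\<^bsub>G\<^esub> p = \<one>\<^bsub>G\<^esub> \<otimes>\<^bsub>G\<^esub> (k \<otimes>\<^bsub>G\<^esub> k \<otimes>\<^bsub>G\<^esub> p)"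
            "(k \<otimes>\<^bsub>G\<^esub> p) [^]\<^bsub>G\<^esub> (2::nat) = p \<otimes>\<^bsub>G\<^esub> (k \<otimes>\<^bsub>G\<^esub> k \<otimes>\<^bsub>G\<^esub> p)"
            using kc p by (simp_all add: numeral_2_eq_2 G.m_ac)
          ultimately have "leq \<one>\<^bsub>G\<^esub> p"
            using G.mult_right_cancel[of "\<one>\<^bsub>G\<^esub>" "k \<otimes>\<^bsub>G\<^esub> k \<otimes>\<^bsub>G\<^esub> p" p] kc p by simp
          with p2 show False by contradiction
        qed
        ultimately show ?thesis
          using d kc p by (simp add: vq Some g C.ple_rep_iff)
      qed
    qed
    then show ?thesis by blast
  qed
  then have "continuous_valuation A ring_topology C.Q ?le ?v"
    unfolding continuous_valuation_iff using vQ by blast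
  moreover have "val_le ?le (?v a) (Some \<one>\<^bsub>C.Q\<^esub>)" if "a \<in> h ` carrier R" for a
  proof -
    from that obtain r where r: "r \<in> carrier R" "a = h r" by blast
    show ?thesis
      using b[OF r(1)] v_Some_closed[of a] r
      by (cases "v a") (auto simp: C.one_coarse_group C.ple_rep_iff C.ple_coarser)
  qed
  ultimately show ?thesis
    unfolding eq points_def Spa_points_def by blast
qed

end

context adic_pair
begin

definition spa :: "('a \<times> 'a) set topology" where
  "spa = Spa A ring_topology (h ` carrier R)"

lemma spa_generated:
  "spa = topology_generated_by
     {{x \<in> points. (f, g) \<in> x \<and> (g, \<zero>\<^bsub>A\<^esub>) \<notin> x} | f g. f \<in> carrier A \<and> g \<in> carrier A}"
  by (simp add: spa_def Spa_def points_def)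

lemma topspace_spa: "topspace spa = points"
proof -
  have "x \<in> {x \<in> points. (\<one>\<^bsub>A\<^esub>, \<one>\<^bsub>A\<^esub>) \<in> x \<and> (\<one>\<^bsub>A\<^esub>, \<zero>\<^bsub>A\<^esub>) \<notin> x}" if "x \<in> points" for x
  proof -
    interpret valuation_relation A x by (rule point_valuation_relation[OF that])
    show ?thesis using that rel_refl[of "\<one>\<^bsub>A\<^esub>"] rel_one by simp
  qed
  then have "points \<subseteq> {x \<in> points. (\<one>\<^bsub>A\<^esub>, \<one>\<^bsub>A\<^esub>) \<in> x \<and> (\<one>\<^bsub>A\<^esub>, \<zero>\<^bsub>A\<^esub>) \<notin> x}" by blast
  then show ?thesis
    unfolding spa_generated topology_generated_by_topspace by blast
qed

lemma openin_spa_basic: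
  assumes "f \<in> carrier A" "g \<in> carrier A"
  shows "openin spa {x \<in> points. (f, g) \<in> x \<and> (g, \<zero>\<^bsub>A\<^esub>) \<notin> x}"
  unfolding spa_generated using assms by (intro topology_generated_by_Basis) blast

lemma generalizes_spa_iff:
  "generalizes spa y x \<longleftrightarrow> x \<in> points \<and> y \<in> points \<and>
     (\<forall>f g. (f, g) \<in> x \<and> (g, \<zero>\<^bsub>A\<^esub>) \<notin> x \<longrightarrow> (f, g) \<in> y \<and> (g, \<zero>\<^bsub>A\<^esub>) \<notin> y)"
  (is "?l \<longleftrightarrow> x \<in> points \<and> y \<in> points \<and> ?r")
proof
  assume ?l
  then have xy: "x \<in> points" "y \<in> points" and op: "\<And>T. \<lbrakk>x \<in> T; openin spa T\<rbrakk> \<Longrightarrow> y \<in> T"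
    unfolding generalizes_def in_closure_of topspace_spa by auto
  interpret valuation_relation A x by (rule point_valuation_relation[OF xy(1)])
  have "(f, g) \<in> y \<and> (g, \<zero>\<^bsub>A\<^esub>) \<notin> y" if "(f, g) \<in> x \<and> (g, \<zero>\<^bsub>A\<^esub>) \<notin> x" for f g
    using op[OF _ openin_spa_basic[of f g]] that xy rel_closed[of f g] by simp
  with xy show "x \<in> points \<and> y \<in> points \<and> ?r" by blast
next
  assume r: "x \<in> points \<and> y \<in> points \<and> ?r"
  have "x \<in> T \<longrightarrow> y \<in> T" if "openin spa T" for T
  proof -
    have "generate_topology_on
        {{x \<in> points. (f, g) \<in> x \<and> (g, \<zero>\<^bsub>A\<^esub>) \<notin> x} | f g. f \<in> carrier A \<and> g \<in> carrier A} T"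
      using that unfolding spa_generated by (rule openin_topology_generated_by)
    then show ?thesis
      by induction (use r in auto)
  qed
  with r show ?l
    unfolding generalizes_def in_closure_of topspace_spa by blast
qed

text \<open>
  By continuity \<open>g\<close> vanishes at a point iff it is bounded there by every power of \<open>w\<close>.  Since \<open>w\<close>
  vanishes nowhere, these conditions are closed under generalization.
\<close>

lemma generalizes_support:
  assumes "generalizes spa y x" "(g, \<zero>\<^bsub>A\<^esub>) \<in> x"
  shows "(g, \<zero>\<^bsub>A\<^esub>) \<in> y"
proof (rule ccontr)
  assume not: "(g, \<zero>\<^bsub>A\<^esub>) \<notin> y"
  have xy: "x \<in> points" "y \<in> points" using assms(1) by (auto simp: generalizes_spa_iff)
  interpret X: valuation_relation A x by (rule point_valuation_relation[OF xy(1)])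
  have g: "g \<in> carrier A" using X.rel_closed[OF assms(2)] by simp
  obtain n :: nat where n: "(g, h w [^]\<^bsub>A\<^esub> n) \<notin> y"
    using point_continuous[OF xy(2) g not] .
  have "(h w [^]\<^bsub>A\<^esub> n, \<zero>\<^bsub>A\<^esub>) \<notin> x"
  proof (induction n)
    case 0
    show ?case using X.rel_one by simp
  next
    case (Suc n)
    show ?case
    proof
      assume "(h w [^]\<^bsub>A\<^esub> Suc n, \<zero>\<^bsub>A\<^esub>) \<in> x"
      then have "(h w [^]\<^bsub>A\<^esub> n \<otimes>\<^bsub>A\<^esub> h w, \<zero>\<^bsub>A\<^esub> \<otimes>\<^bsub>A\<^esub> h w) \<in> x" by simp
      then show False
        using X.rel_cancel[OF _ point_hw_nonzero[OF xy(1)]] Suc by simp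
    qed
  qed
  moreover have "(g, h w [^]\<^bsub>A\<^esub> n) \<in> x"
    using X.rel_trans[OF assms(2) X.rel_zero] by simp
  ultimately have "(g, h w [^]\<^bsub>A\<^esub> n) \<in> y"
    using assms(1) unfolding generalizes_spa_iff by blast
  with n show False by contradiction
qed

lemma max_gen_generalizes:
  assumes "x \<in> points"
  shows "generalizes spa (max_gen x) x"
  unfolding generalizes_spa_iff
proof (intro conjI allI impI)
  interpret valuation_relation A x by (rule point_valuation_relation[OF assms])
  fix f g assume fg: "(f, g) \<in> x \<and> (g, \<zero>\<^bsub>A\<^esub>) \<notin> x"
  have mem: "f \<in> carrier A" "g \<in> carrier A" using fg rel_closed by blast+
  have "(f [^]\<^bsub>A\<^esub> n \<otimes>\<^bsub>A\<^esub> h w, g [^]\<^bsub>A\<^esub> n) \<in> x" for n :: nat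
    using rel_mult_mono[OF rel_pow_mono point_bounded[OF assms w_closed], of f g n] fg mem by simp
  then show "(f, g) \<in> max_gen x" using mem by (simp add: max_gen_def)
  show "(g, \<zero>\<^bsub>A\<^esub>) \<notin> max_gen x"
  proof
    assume "(g, \<zero>\<^bsub>A\<^esub>) \<in> max_gen x"
    then have "(g [^]\<^bsub>A\<^esub> (1::nat) \<otimes>\<^bsub>A\<^esub> h w, \<zero>\<^bsub>A\<^esub> [^]\<^bsub>A\<^esub> (1::nat)) \<in> x"
      unfolding max_gen_def by blast
    then have "(g \<otimes>\<^bsub>A\<^esub> h w, \<zero>\<^bsub>A\<^esub> \<otimes>\<^bsub>A\<^esub> h w) \<in> x" using mem by simp
    then show False
      using rel_cancel[OF _ point_hw_nonzero[OF assms]] mem fg by simp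
  qed
qed (use assms max_gen_point in auto)

text \<open>
  If \<open>f \<le> g\<close> at a generalization \<open>y\<close>, then no power of \<open>f/g\<close> can exceed \<open>1/w\<close> at \<open>x\<close>: such an
  inequality would persist at \<open>y\<close>, and there it contradicts that \<open>w\<close> is less than one.
\<close>

lemma generalizes_subset_max_gen:
  assumes "generalizes spa y x"
  shows "y \<subseteq> max_gen x"
proof clarify
  fix f g assume fg: "(f, g) \<in> y"
  have xy: "x \<in> points" "y \<in> points" using assms by (auto simp: generalizes_spa_iff)
  interpret X: valuation_relation A x by (rule point_valuation_relation[OF xy(1)])
  interpret Y: valuation_relation A y by (rule point_valuation_relation[OF xy(2)])
  have mem [simp]: "f \<in> carrier A" "g \<in> carrier A" using Y.rel_closed[OF fg] by auto
  have "(f [^]\<^bsub>A\<^esub> n \<otimes>\<^bsub>A\<^esub> h w, g [^]\<^bsub>A\<^esub> n) \<in> x" for n :: nat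
  proof (rule ccontr)
    assume not: "(f [^]\<^bsub>A\<^esub> n \<otimes>\<^bsub>A\<^esub> h w, g [^]\<^bsub>A\<^esub> n) \<notin> x"
    then have "(g [^]\<^bsub>A\<^esub> n, f [^]\<^bsub>A\<^esub> n \<otimes>\<^bsub>A\<^esub> h w) \<in> x"
      using X.rel_total[of "f [^]\<^bsub>A\<^esub> n \<otimes>\<^bsub>A\<^esub> h w" "g [^]\<^bsub>A\<^esub> n"] by simp
    moreover have "(f [^]\<^bsub>A\<^esub> n \<otimes>\<^bsub>A\<^esub> h w, \<zero>\<^bsub>A\<^esub>) \<notin> x"
    proof
      assume "(f [^]\<^bsub>A\<^esub> n \<otimes>\<^bsub>A\<^esub> h w, \<zero>\<^bsub>A\<^esub>) \<in> x"
      moreover have "(\<zero>\<^bsub>A\<^esub>, g [^]\<^bsub>A\<^esub> n) \<in> x" by (rule X.rel_zero) simp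
      ultimately show False using not X.rel_trans by blast
    qed
    ultimately have gf: "(g [^]\<^bsub>A\<^esub> n, f [^]\<^bsub>A\<^esub> n \<otimes>\<^bsub>A\<^esub> h w) \<in> y"
      and nz: "(f [^]\<^bsub>A\<^esub> n \<otimes>\<^bsub>A\<^esub> h w, \<zero>\<^bsub>A\<^esub>) \<notin> y"
      using assms unfolding generalizes_spa_iff by blast+
    have "(f [^]\<^bsub>A\<^esub> n, f [^]\<^bsub>A\<^esub> n \<otimes>\<^bsub>A\<^esub> h w) \<in> y"
      using Y.rel_trans[OF Y.rel_pow_mono[OF fg] gf] .
    then have "(\<one>\<^bsub>A\<^esub> \<otimes>\<^bsub>A\<^esub> f [^]\<^bsub>A\<^esub> n, h w \<otimes>\<^bsub>A\<^esub> f [^]\<^bsub>A\<^esub> n) \<in> y"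
      by (simp add: A.m_comm)
    moreover have "(f [^]\<^bsub>A\<^esub> n, \<zero>\<^bsub>A\<^esub>) \<notin> y"
    proof
      assume "(f [^]\<^bsub>A\<^esub> n, \<zero>\<^bsub>A\<^esub>) \<in> y"
      from Y.rel_mult[OF this, of "h w"] nz show False by simp
    qed
    ultimately have "(\<one>\<^bsub>A\<^esub>, h w) \<in> y"
      by (rule Y.rel_cancel) simp_all
    with point_hw_less_one[OF xy(2)] show False by contradiction
  qed
  then show "(f, g) \<in> max_gen x" by (simp add: max_gen_def)
qed

lemma generalizes_trans:
  "\<lbrakk>generalizes spa z y; generalizes spa y x\<rbrakk> \<Longrightarrow> generalizes spa z x"
  unfolding generalizes_spa_iff by blast

lemma generalizes_max_gen_eq:
  assumes "x \<in> points" "generalizes spa z (max_gen x)"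
  shows "z = max_gen x"
proof
  have "generalizes spa z x"
    using generalizes_trans[OF assms(2) max_gen_generalizes[OF assms(1)]] .
  then show "z \<subseteq> max_gen x" by (rule generalizes_subset_max_gen)
  have pts: "max_gen x \<in> points" "z \<in> points"
    using assms(2) by (auto simp: generalizes_spa_iff)
  interpret X: valuation_relation A "max_gen x" by (rule point_valuation_relation[OF pts(1)])
  interpret Z: valuation_relation A z by (rule point_valuation_relation[OF pts(2)])
  show "max_gen x \<subseteq> z"
  proof clarify
    fix f g assume fg: "(f, g) \<in> max_gen x"
    show "(f, g) \<in> z"
    proof (cases "(g, \<zero>\<^bsub>A\<^esub>) \<in> max_gen x")
      case True
      then have "(f, \<zero>\<^bsub>A\<^esub>) \<in> z"
        using generalizes_support[OF assms(2)] X.rel_trans[OF fg] by blast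
      then show ?thesis
        using Z.rel_trans Z.rel_zero X.rel_closed[OF fg] by blast
    next
      case False
      then show ?thesis using fg assms(2) unfolding generalizes_spa_iff by blast
    qed
  qed
qed

text \<open>Any generalization lies between \<open>x\<close> and \<open>max_gen x\<close>, so it cannot be maximal unless it equals the latter.\<close>

lemma max_gen_generalizes_generalization:
  assumes "generalizes spa y x"
  shows "generalizes spa (max_gen x) y"
  unfolding generalizes_spa_iff
proof (intro conjI allI impI)
  have xy: "x \<in> points" "y \<in> points" using assms by (auto simp: generalizes_spa_iff)
  then show "y \<in> points" "max_gen x \<in> points" using max_gen_point by auto
  fix f g assume fg: "(f, g) \<in> y \<and> (g, \<zero>\<^bsub>A\<^esub>) \<notin> y"
  then show "(f, g) \<in> max_gen x" using generalizes_subset_max_gen[OF assms] by blast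
  have "(g, \<zero>\<^bsub>A\<^esub>) \<notin> x" using fg generalizes_support[OF assms] by blast
  moreover have "g \<in> carrier A"
    using fg valuation_relation.rel_closed[OF point_valuation_relation[OF xy(2)]] by blast
  then have "(g, g) \<in> x"
    using valuation_relation.rel_refl[OF point_valuation_relation[OF xy(1)]] by blast
  ultimately show "(g, \<zero>\<^bsub>A\<^esub>) \<notin> max_gen x"
    using max_gen_generalizes[OF xy(1)] unfolding generalizes_spa_iff by blast
qed

theorem maximal_generalization_spa:
  assumes "x \<in> points"
  shows "maximal_generalization spa x = max_gen x"
  unfolding maximal_generalization_def
proof (rule the_equality)
  show "generalizes spa (max_gen x) x \<and> (\<forall>z. generalizes spa z (max_gen x) \<longrightarrow> z = max_gen x)"
    using max_gen_generalizes[OF assms] generalizes_max_gen_eq[OF assms] by blast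
  show "y = max_gen x" if "generalizes spa y x \<and> (\<forall>z. generalizes spa z y \<longrightarrow> z = y)" for y
    using that max_gen_generalizes_generalization by blast
qed

text \<open>
  If \<open>a\<^sup>n \<le> w\<close> at \<open>x\<close>, then \<open>a\<^sup>2\<^sup>n \<le> w\<^sup>2\<close> is even strictly less than \<open>w\<close>, and the failure of
  \<open>w \<le> a\<^sup>2\<^sup>n\<close> is what separates \<open>a\<close> from the unit at the maximal generalization.  The right-hand
  side refers to \<open>x\<close> itself, so it describes a set of points by basic open conditions.
\<close>

lemma max_gen_less_one_iff:
  assumes "x \<in> points" "a \<in> carrier A"
  shows "(\<one>\<^bsub>A\<^esub>, a) \<notin> max_gen x \<longleftrightarrow> (\<exists>n::nat. (a [^]\<^bsub>A\<^esub> n, h w) \<in> x)"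
proof
  interpret valuation_relation A x by (rule point_valuation_relation[OF assms(1)])
  assume "(\<one>\<^bsub>A\<^esub>, a) \<notin> max_gen x"
  then obtain n :: nat where "(\<one>\<^bsub>A\<^esub> [^]\<^bsub>A\<^esub> n \<otimes>\<^bsub>A\<^esub> h w, a [^]\<^bsub>A\<^esub> n) \<notin> x"
    using assms(2) by (auto simp: max_gen_def)
  then show "\<exists>n::nat. (a [^]\<^bsub>A\<^esub> n, h w) \<in> x"
    using rel_total[of "h w" "a [^]\<^bsub>A\<^esub> n"] assms(2) by auto
next
  interpret valuation_relation A x by (rule point_valuation_relation[OF assms(1)])
  assume "\<exists>n::nat. (a [^]\<^bsub>A\<^esub> n, h w) \<in> x"
  then obtain n :: nat where n: "(a [^]\<^bsub>A\<^esub> n, h w) \<in> x" by blast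
  show "(\<one>\<^bsub>A\<^esub>, a) \<notin> max_gen x"
  proof
    assume "(\<one>\<^bsub>A\<^esub>, a) \<in> max_gen x"
    then have "(\<one>\<^bsub>A\<^esub> [^]\<^bsub>A\<^esub> (n + n) \<otimes>\<^bsub>A\<^esub> h w, a [^]\<^bsub>A\<^esub> (n + n)) \<in> x"
      unfolding max_gen_def by blast
    then have "(h w, a [^]\<^bsub>A\<^esub> n \<otimes>\<^bsub>A\<^esub> a [^]\<^bsub>A\<^esub> n) \<in> x"
      using assms(2) by (simp add: A.nat_pow_mult)
    then have "(\<one>\<^bsub>A\<^esub> \<otimes>\<^bsub>A\<^esub> h w, h w \<otimes>\<^bsub>A\<^esub> h w) \<in> x"
      using rel_trans[OF _ rel_mult_mono[OF n n]] by simp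
    then have "(\<one>\<^bsub>A\<^esub>, h w) \<in> x"
      by (rule rel_cancel) (use point_hw_nonzero[OF assms(1)] in simp_all)
    with point_hw_less_one[OF assms(1)] show False by contradiction
  qed
qed

lemma openin_max_gen_less_one:
  assumes "a \<in> carrier A"
  shows "openin spa {x \<in> points. (\<one>\<^bsub>A\<^esub>, a) \<notin> max_gen x}"
proof -
  have "(\<one>\<^bsub>A\<^esub>, a) \<in> max_gen x \<longleftrightarrow> (\<forall>n::nat. (a [^]\<^bsub>A\<^esub> n, h w) \<notin> x)" if "x \<in> points" for x
    using max_gen_less_one_iff[OF that assms] by blast
  then have "{x \<in> points. (\<one>\<^bsub>A\<^esub>, a) \<notin> max_gen x}
      = (\<Union>n::nat. {x \<in> points. (a [^]\<^bsub>A\<^esub> n, h w) \<in> x \<and> (h w, \<zero>\<^bsub>A\<^esub>) \<notin> x})"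
    by (auto simp: point_hw_nonzero)
  then show ?thesis
    using assms openin_spa_basic by auto
qed

end

section \<open>Closed subsets of a spectrum with noetherian reduction\<close>

text \<open>
  Among the ideals generated by finite subsets of \<open>S\<close> there is a maximal one; it contains \<open>S\<close>.
\<close>

lemma (in noetherian_ring) finite_subset_generates:
  assumes S: "S \<subseteq> carrier R"
  obtains F where "finite F" "F \<subseteq> S" "S \<subseteq> Idl F"
proof -
  let ?I = "{Idl F | F. finite F \<and> F \<subseteq> S}"
  have "\<exists>M\<in>?I. \<forall>X\<in>?I. M \<subseteq> X \<longrightarrow> X = M"
  proof (rule subset_Zorn_nonempty)
    show "?I \<noteq> {}" by blast
    fix C assume C: "C \<noteq> {}" "subset.chain ?I C"
    have "?I \<subseteq> {I. ideal I R}"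
      using S genideal_ideal by blast
    then have "subset.chain {I. ideal I R} C"
      using C(2) unfolding subset_chain_def by blast
    from ideal_chain_is_trivial[OF C(1) this] show "\<Union>C \<in> ?I"
      using C(2) unfolding subset_chain_def by blast
  qed
  then obtain M where M: "M \<in> ?I" and max: "\<forall>X\<in>?I. M \<subseteq> X \<longrightarrow> X = M"
    by (rule bexE)
  from M obtain F where F: "finite F" "F \<subseteq> S" "M = Idl F" by blast
  have "s \<in> Idl F" if s: "s \<in> S" for s
  proof -
    have sub: "insert s F \<subseteq> carrier R" using s F S by blast
    have "insert s F \<subseteq> Idl (insert s F)" by (rule genideal_self[OF sub])
    then have "s \<in> Idl (insert s F)" "Idl F \<subseteq> Idl (insert s F)"
      using genideal_minimal[OF genideal_ideal[OF sub], of F] by auto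
    moreover have "Idl (insert s F) \<in> ?I" using s F by blast
    ultimately show ?thesis using max F(3) by auto
  qed
  then show ?thesis by (intro that[OF F(1,2)]) blast
qed

context cring
begin

text \<open>
  The factor \<open>c\<close> replaces the binomial theorem: one factor \<open>a \<oplus> b\<close> is expanded at a time, and its
  summands are absorbed into \<open>c\<close>.
\<close>

lemma mult_sum_pow_eq_zero:
  assumes "a \<in> carrier R" "b \<in> carrier R" "c \<in> carrier R"
    and "c \<otimes> a [^] (m::nat) = \<zero>" "c \<otimes> b [^] (n::nat) = \<zero>"
  shows "c \<otimes> (a \<oplus> b) [^] (m + n) = \<zero>"
  using assms
proof (induction "m + n" arbitrary: m n c)
  case 0
  then show ?case by simp
next
  case (Suc k)
  show ?case
  proof (cases "m = 0 \<or> n = 0")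
    case True
    then have "c = \<zero>" using Suc.prems by auto
    then show ?thesis using Suc.prems by simp
  next
    case False
    then obtain m' n' where mn: "m = Suc m'" "n = Suc n'" by (metis not0_implies_Suc)
    have "(c \<otimes> a) \<otimes> (a \<oplus> b) [^] (m' + n) = \<zero>"
    proof (rule Suc.hyps(1))
      have "(c \<otimes> a) \<otimes> b [^] n = (c \<otimes> b [^] n) \<otimes> a"
        using Suc.prems(1-3) by (simp add: m_ac)
      then show "(c \<otimes> a) \<otimes> b [^] n = \<zero>" using Suc.prems by simp
    qed (use Suc.prems Suc.hyps(2) mn in \<open>simp_all add: m_ac\<close>)
    moreover have "(c \<otimes> b) \<otimes> (a \<oplus> b) [^] (m + n') = \<zero>"
    proof (rule Suc.hyps(1))
      have "(c \<otimes> b) \<otimes> a [^] m = (c \<otimes> a [^] m) \<otimes> b"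
        using Suc.prems(1-3) by (simp add: m_ac)
      then show "(c \<otimes> b) \<otimes> a [^] m = \<zero>" using Suc.prems by simp
    qed (use Suc.prems Suc.hyps(2) mn in \<open>simp_all add: m_ac\<close>)
    moreover have "m + n = Suc (m' + n)" "m + n' = m' + n"
      using mn by simp_all
    moreover have "c \<otimes> (a \<oplus> b) [^] Suc (m' + n)
        = (c \<otimes> a) \<otimes> (a \<oplus> b) [^] (m' + n) \<oplus> (c \<otimes> b) \<otimes> (a \<oplus> b) [^] (m' + n)"
      using Suc.prems(1-3) by (simp add: l_distr r_distr m_ac)
    ultimately show ?thesis by simp
  qed
qed

lemma nilradical_ideal: "ideal (nilradical R) R"
proof (rule idealI)
  have mult: "x \<otimes> a \<in> nilradical R" if "a \<in> nilradical R" "x \<in> carrier R" for a x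
  proof -
    obtain n :: nat where n: "a \<in> carrier R" "a [^] n = \<zero>"
      using \<open>a \<in> nilradical R\<close> unfolding nilradical_def by blast
    then have "(x \<otimes> a) [^] n = \<zero>" using that(2) by (simp add: nat_pow_distrib)
    then show ?thesis using n(1) that(2) unfolding nilradical_def by auto
  qed
  then show "x \<otimes> a \<in> nilradical R" if "a \<in> nilradical R" "x \<in> carrier R" for a x
    using that .
  show "a \<otimes> x \<in> nilradical R" if "a \<in> nilradical R" "x \<in> carrier R" for a x
    using mult[OF that] that m_comm[of a x] by (simp add: nilradical_def)
  show "subgroup (nilradical R) (add_monoid R)"
  proof (rule add.subgroupI)
    show "nilradical R \<subseteq> carrier R" by (auto simp: nilradical_def)
    have "\<zero> \<in> nilradical R" unfolding nilradical_def by (auto intro!: exI[of _ "1::nat"])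
    then show "nilradical R \<noteq> {}" by blast
    show "\<ominus> a \<in> nilradical R" if "a \<in> nilradical R" for a
      using mult[OF that, of "\<ominus> \<one>"] that by (simp add: nilradical_def l_minus)
    show "a \<oplus> b \<in> nilradical R" if ab: "a \<in> nilradical R" "b \<in> nilradical R" for a b
    proof -
      obtain m n :: nat where "a \<in> carrier R" "b \<in> carrier R" "a [^] m = \<zero>" "b [^] n = \<zero>"
        using ab unfolding nilradical_def by blast
      moreover from this have "\<one> \<otimes> (a \<oplus> b) [^] (m + n) = \<zero>"
        by (intro mult_sum_pow_eq_zero) simp_all
      ultimately show ?thesis unfolding nilradical_def by auto
    qed
  qed
qed (rule ring_axioms)

lemma primeideal_pow_mem:
  assumes "primeideal p R" "a \<in> carrier R" "a [^] (n::nat) \<in> p"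
  shows "a \<in> p"
  using assms(3)
proof (induction n)
  case 0
  interpret primeideal p R by fact
  show ?case using 0 one_imp_carrier assms(2) by simp
next
  case (Suc n)
  then show ?case using primeideal.I_prime[OF assms(1), of "a [^] n" a] assms(2) by auto
qed

text \<open>
  Every prime contains the nilradical, so containments between primes and sets of elements can be
  tested in the quotient by the nilradical.
\<close>

lemma finite_subset_same_primes:
  assumes noeth: "noetherian_ring (R Quot (nilradical R))" and S: "S \<subseteq> carrier R"
  obtains F where "finite F" "F \<subseteq> S" "\<And>p. primeideal p R \<Longrightarrow> F \<subseteq> p \<Longrightarrow> S \<subseteq> p"
proof -
  let ?N = "nilradical R"
  interpret N: ideal ?N R by (rule nilradical_ideal)
  interpret Q: noetherian_ring "R Quot ?N" by (rule noeth)
  have "(+>) ?N ` S \<subseteq> carrier (R Quot ?N)"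
    using S ring_hom_closed[OF N.rcos_ring_hom] by blast
  then obtain F' where F': "finite F'" "F' \<subseteq> (+>) ?N ` S" "(+>) ?N ` S \<subseteq> Idl\<^bsub>R Quot ?N\<^esub> F'"
    by (rule Q.finite_subset_generates)
  obtain F where F: "F \<subseteq> S" "finite F" "F' = (+>) ?N ` F"
    using finite_subset_image[OF F'(1,2)] by blast
  have "S \<subseteq> p" if p: "primeideal p R" and Fp: "F \<subseteq> p" for p
  proof
    interpret primeideal p R by fact
    fix s assume s: "s \<in> S"
    have "ideal ((+>) ?N ` p) (R Quot ?N)"
      by (rule ring_ideal_imp_quot_ideal[OF nilradical_ideal is_ideal])
    then have "Idl\<^bsub>R Quot ?N\<^esub> F' \<subseteq> (+>) ?N ` p"
      by (rule Q.genideal_minimal) (use F(3) Fp in blast)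
    then obtain q where q: "q \<in> p" "?N +> s = ?N +> q"
      using F'(3) s by blast
    have "s \<in> ?N +> q"
      using N.a_rcos_self[of s] s S q(2) by auto
    then obtain n where n: "n \<in> ?N" "s = n \<oplus> q"
      unfolding a_r_coset_def' by blast
    obtain k :: nat where k: "n \<in> carrier R" "n [^] k = \<zero>"
      using n(1) unfolding nilradical_def by blast
    have "n \<in> p"
      by (rule primeideal_pow_mem[OF p k(1), of k])
        (simp add: k(2) additive_subgroup.zero_closed[OF additive_subgroup_axioms])
    then show "s \<in> p" using n(2) q(1) by simp
  qed
  with F that show ?thesis by blast
qed

lemma coset_mem_image_iff:
  assumes "ideal I R" "ideal P R" "I \<subseteq> P" "a \<in> carrier R"
  shows "I +> a \<in> (+>) I ` P \<longleftrightarrow> a \<in> P"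
proof
  interpret I: ideal I R by fact
  interpret P: ideal P R by fact
  assume "I +> a \<in> (+>) I ` P"
  then obtain c where c: "c \<in> P" "I +> a = I +> c" by blast
  have "a \<in> I +> c"
    using I.a_rcos_self[OF assms(4)] c(2) by simp
  then obtain i where "i \<in> I" "a = i \<oplus> c"
    unfolding a_r_coset_def' by blast
  then show "a \<in> P" using assms(3) c(1) by auto
qed blast

lemma primeideal_image_quotient:
  assumes I: "ideal I R" and P: "primeideal P R" and sub: "I \<subseteq> P"
  shows "primeideal ((+>) I ` P) (R Quot I)"
proof (rule primeidealI)
  interpret I: ideal I R by fact
  interpret P: primeideal P R by fact
  note mem = coset_mem_image_iff[OF I P.is_ideal sub]
  have carr: "\<exists>a\<in>carrier R. x = I +> a" if "x \<in> carrier (R Quot I)" for x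
    using that by (auto simp: FactRing_def A_RCOSETS_def')
  show "ideal ((+>) I ` P) (R Quot I)"
    by (rule ring_ideal_imp_quot_ideal[OF I P.is_ideal])
  show "cring (R Quot I)" by (rule I.quotient_is_cring[OF is_cring])
  show "carrier (R Quot I) \<noteq> (+>) I ` P"
  proof
    assume "carrier (R Quot I) = (+>) I ` P"
    moreover have "I +> \<one> \<in> carrier (R Quot I)"
      using ring_hom_closed[OF I.rcos_ring_hom one_closed] .
    ultimately have "\<one> \<in> P" using mem[OF one_closed] by simp
    then show False using P.one_imp_carrier P.I_notcarr by simp
  qed
  fix x y assume "x \<in> carrier (R Quot I)" "y \<in> carrier (R Quot I)"
    and xy: "x \<otimes>\<^bsub>R Quot I\<^esub> y \<in> (+>) I ` P"
  then obtain a b where ab: "a \<in> carrier R" "b \<in> carrier R" "x = I +> a" "y = I +> b"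
    using carr by metis
  have "I +> (a \<otimes> b) \<in> (+>) I ` P"
    using xy ab ring_hom_mult[OF I.rcos_ring_hom ab(1,2)] by simp
  then have "a \<otimes> b \<in> P" using ab mem by simp
  then show "x \<in> (+>) I ` P \<or> y \<in> (+>) I ` P"
    using ab P.I_prime by blast
qed

end

lemma topspace_zariski_space:
  "topspace (zariski_space A) = {p. primeideal p A}"
proof -
  have "openin (zariski_space A) {p. primeideal p A}"
    unfolding openin_zariski_space
  proof (intro exI conjI)
    show "carrier A \<subseteq> carrier A" ..
    have "\<not> (primeideal p A \<and> carrier A \<subseteq> p)" for p
    proof (rule notI, elim conjE)
      assume "primeideal p A" "carrier A \<subseteq> p"
      interpret primeideal p A by fact
      show False using \<open>carrier A \<subseteq> p\<close> a_subset I_notcarr by blast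
    qed
    then show "{p. primeideal p A} = {p. primeideal p A} - {p. primeideal p A \<and> carrier A \<subseteq> p}"
      by blast
  qed
  moreover have "U \<subseteq> {p. primeideal p A}" if "openin (zariski_space A) U" for U
    using that unfolding openin_zariski_space by blast
  ultimately show ?thesis
    unfolding topspace_def by blast
qed

lemma closedin_zariski_space:
  assumes "closedin (zariski_space A) C"
  obtains S where "S \<subseteq> carrier A" "C = {p. primeideal p A \<and> S \<subseteq> p}"
proof -
  obtain S where S: "S \<subseteq> carrier A"
    "{p. primeideal p A} - C = {p. primeideal p A} - {p. primeideal p A \<and> S \<subseteq> p}"
    using assms unfolding closedin_def topspace_zariski_space openin_zariski_space by blast
  moreover have "C \<subseteq> {p. primeideal p A}"
    using assms unfolding closedin_def topspace_zariski_space by blast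
  ultimately have "C = {p. primeideal p A \<and> S \<subseteq> p}" by blast
  with S(1) show ?thesis by (rule that)
qed

section \<open>The maximal specialization map\<close>

context adic_pair
begin

definition less_one_ideal :: "('a \<times> 'a) set \<Rightarrow> 'r set" where
  "less_one_ideal y = {a \<in> carrier R. (\<one>\<^bsub>A\<^esub>, h a) \<notin> y}"

lemma less_one_ideal_prime:
  assumes y: "y \<in> points"
  shows "primeideal (less_one_ideal y) R"
proof (rule primeidealI)
  interpret valuation_relation A y by (rule point_valuation_relation[OF y])
  have mult: "x \<otimes>\<^bsub>R\<^esub> a \<in> less_one_ideal y" if "a \<in> less_one_ideal y" "x \<in> carrier R" for a x
  proof -
    have a: "a \<in> carrier R" "(\<one>\<^bsub>A\<^esub>, h a) \<notin> y" using that(1) by (auto simp: less_one_ideal_def)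
    have "(h x \<otimes>\<^bsub>A\<^esub> h a, \<one>\<^bsub>A\<^esub> \<otimes>\<^bsub>A\<^esub> h a) \<in> y"
      using point_bounded[OF y that(2)] a by (intro rel_mult) simp_all
    then have "(h (x \<otimes>\<^bsub>R\<^esub> a), h a) \<in> y" using a that(2) by (simp add: h_mult)
    then show ?thesis
      using a that(2) rel_trans unfolding less_one_ideal_def by blast
  qed
  show "ideal (less_one_ideal y) R"
  proof (rule idealI)
    show "x \<otimes>\<^bsub>R\<^esub> a \<in> less_one_ideal y" if "a \<in> less_one_ideal y" "x \<in> carrier R" for a x
      using mult that .
    show "a \<otimes>\<^bsub>R\<^esub> x \<in> less_one_ideal y" if "a \<in> less_one_ideal y" "x \<in> carrier R" for a x
      using mult[OF that] that R.m_comm[of a x] by (simp add: less_one_ideal_def)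
    show "subgroup (less_one_ideal y) (add_monoid R)"
    proof (rule R.add.subgroupI)
      show "less_one_ideal y \<subseteq> carrier R" by (auto simp: less_one_ideal_def)
      have "\<zero>\<^bsub>R\<^esub> \<in> less_one_ideal y" using rel_one by (simp add: less_one_ideal_def h_zero)
      then show "less_one_ideal y \<noteq> {}" by blast
      show "\<ominus>\<^bsub>R\<^esub> a \<in> less_one_ideal y" if "a \<in> less_one_ideal y" for a
        using mult[OF that, of "\<ominus>\<^bsub>R\<^esub> \<one>\<^bsub>R\<^esub>"] that by (simp add: less_one_ideal_def R.l_minus)
      show "a \<oplus>\<^bsub>R\<^esub> b \<in> less_one_ideal y" if ab: "a \<in> less_one_ideal y" "b \<in> less_one_ideal y" for a b
      proof -
        have mem: "a \<in> carrier R" "b \<in> carrier R" using ab by (auto simp: less_one_ideal_def)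
        have "\<exists>c\<in>{a, b}. (h a, h c) \<in> y \<and> (h b, h c) \<in> y"
          using rel_total[of "h a" "h b"] rel_refl[of "h a"] rel_refl[of "h b"] mem by auto
        then obtain c where c: "c \<in> less_one_ideal y" "(h a, h c) \<in> y" "(h b, h c) \<in> y"
          using ab by blast
        have "(h (a \<oplus>\<^bsub>R\<^esub> b), h c) \<in> y" using rel_add[OF c(2,3)] mem by (simp add: h_add)
        then show ?thesis
          using c(1) mem rel_trans unfolding less_one_ideal_def by blast
      qed
    qed
  qed (rule R.ring_axioms)
  show "carrier R \<noteq> less_one_ideal y"
  proof
    assume "carrier R = less_one_ideal y"
    then have "\<one>\<^bsub>R\<^esub> \<in> less_one_ideal y" using R.one_closed by simp
    then show False using rel_refl[of "\<one>\<^bsub>A\<^esub>"] by (simp add: less_one_ideal_def h_one)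
  qed
  show "a \<in> less_one_ideal y \<or> b \<in> less_one_ideal y"
    if "a \<in> carrier R" "b \<in> carrier R" "a \<otimes>\<^bsub>R\<^esub> b \<in> less_one_ideal y" for a b
    using that rel_mult_mono[of "\<one>\<^bsub>A\<^esub>" "h a" "\<one>\<^bsub>A\<^esub>" "h b"] by (auto simp: less_one_ideal_def h_mult)
qed (rule R.is_cring)

lemma uniformizer_subset_less_one_ideal:
  assumes "y \<in> points"
  shows "PIdl\<^bsub>R\<^esub> w \<subseteq> less_one_ideal y"
proof (rule R.cgenideal_minimal)
  show "ideal (less_one_ideal y) R"
    using less_one_ideal_prime[OF assms] by (rule primeideal.axioms(1))
  show "w \<in> less_one_ideal y"
    using point_hw_less_one[OF assms] by (simp add: less_one_ideal_def)
qed

definition special_point :: "('a \<times> 'a) set \<Rightarrow> 'r set set" where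
  "special_point y = {PIdl\<^bsub>R\<^esub> w +>\<^bsub>R\<^esub> a | a. a \<in> carrier R \<and> (h a, \<one>\<^bsub>A\<^esub>) \<in> y \<and> (\<one>\<^bsub>A\<^esub>, h a) \<notin> y}"

lemma special_point_eq:
  assumes "y \<in> points"
  shows "special_point y = (+>\<^bsub>R\<^esub>) (PIdl\<^bsub>R\<^esub> w) ` less_one_ideal y"
  using point_bounded[OF assms] unfolding special_point_def less_one_ideal_def by auto

lemma special_point_prime:
  assumes "y \<in> points"
  shows "primeideal (special_point y) (special_fiber_ring R w)"
  unfolding special_point_eq[OF assms] special_fiber_ring_def
  using assms by (intro R.primeideal_image_quotient R.cgenideal_ideal w_closed less_one_ideal_prime
      uniformizer_subset_less_one_ideal)

lemma coset_mem_special_point_iff: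
  assumes "y \<in> points" "a \<in> carrier R"
  shows "PIdl\<^bsub>R\<^esub> w +>\<^bsub>R\<^esub> a \<in> special_point y \<longleftrightarrow> (\<one>\<^bsub>A\<^esub>, h a) \<notin> y"
proof -
  have "ideal (less_one_ideal y) R"
    using less_one_ideal_prime[OF assms(1)] by (rule primeideal.axioms(1))
  from R.coset_mem_image_iff[OF R.cgenideal_ideal[OF w_closed] this
      uniformizer_subset_less_one_ideal[OF assms(1)] assms(2)]
  show ?thesis
    using assms(2) by (simp add: special_point_eq[OF assms(1)] less_one_ideal_def)
qed

theorem anticontinuous_max_specialization:
  assumes noeth: "noetherian_ring (reduced_special_fiber_ring R w)"
  shows "anticontinuous_map spa (zariski_space (special_fiber_ring R w))
    (\<lambda>x. special_point (maximal_generalization spa x))"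
proof -
  let ?B = "special_fiber_ring R w"
  let ?f = "\<lambda>x. special_point (maximal_generalization spa x)"
  interpret I: ideal "PIdl\<^bsub>R\<^esub> w" R by (rule R.cgenideal_ideal[OF w_closed])
  interpret B: cring ?B
    unfolding special_fiber_ring_def by (rule I.quotient_is_cring[OF R.is_cring])
  have maps: "?f x \<in> topspace (zariski_space ?B)" if "x \<in> points" for x
    using special_point_prime[OF max_gen_point[OF that]] maximal_generalization_spa[OF that]
    by (simp add: topspace_zariski_space)
  have op: "openin spa {x \<in> points. ?f x \<in> C}" if C: "closedin (zariski_space ?B) C" for C
  proof -
    obtain S where S: "S \<subseteq> carrier ?B" "C = {p. primeideal p ?B \<and> S \<subseteq> p}"
      using closedin_zariski_space[OF C] .
    \<comment> \<open>Openness survives only finite intersections, so \<open>S\<close> is replaced by a finite subset.\<close>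
    obtain F where F: "finite F" "F \<subseteq> S" and FS: "\<And>p. primeideal p ?B \<Longrightarrow> F \<subseteq> p \<Longrightarrow> S \<subseteq> p"
      using B.finite_subset_same_primes[OF _ S(1)] noeth unfolding reduced_special_fiber_ring_def by blast
    have "openin spa {x \<in> points. c \<in> special_point (max_gen x)}" if "c \<in> F" for c
    proof -
      obtain a where a: "a \<in> carrier R" "c = PIdl\<^bsub>R\<^esub> w +>\<^bsub>R\<^esub> a"
        using \<open>c \<in> F\<close> F S(1) by (auto simp: special_fiber_ring_def FactRing_def A_RCOSETS_def')
      have "{x \<in> points. c \<in> special_point (max_gen x)} = {x \<in> points. (\<one>\<^bsub>A\<^esub>, h a) \<notin> max_gen x}"
        using a(1) max_gen_point by (auto simp: a(2) coset_mem_special_point_iff)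
      then show ?thesis using openin_max_gen_less_one[of "h a"] a by simp
    qed
    \<comment> \<open>The empty intersection is the universe of the type and not the whole space.\<close>
    then have "openin spa (\<Inter>c\<in>F. {x \<in> points. c \<in> special_point (max_gen x)})" if "F \<noteq> {}"
      using F(1) that by (intro openin_INT2) auto
    moreover have "{x \<in> points. ?f x \<in> C} = points \<inter> (\<Inter>c\<in>F. {x \<in> points. c \<in> special_point (max_gen x)})"
    proof -
      have "?f x \<in> C \<longleftrightarrow> F \<subseteq> special_point (max_gen x)" if "x \<in> points" for x
        using special_point_prime[OF max_gen_point[OF that]] F(2) FS
        unfolding maximal_generalization_spa[OF that] S(2) by blast
      then show ?thesis by blast
    qed
    moreover have "openin spa points" using openin_topspace[of spa] by (simp add: topspace_spa)
    ultimately show ?thesis by (cases "F = {}") (simp_all add: openin_Int)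
  qed
  have "closedin spa {x \<in> points. ?f x \<in> U}" if "openin (zariski_space ?B) U" for U
  proof -
    have "closedin (zariski_space ?B) (topspace (zariski_space ?B) - U)"
      using that by (simp add: closedin_def openin_subset double_diff)
    from op[OF this] have "openin spa (points - {x \<in> points. ?f x \<in> U})"
      by (rule back_subst[of "openin spa"]) (use maps in blast)
    then show ?thesis
      unfolding closedin_def topspace_spa by blast
  qed
  then show ?thesis
    unfolding anticontinuous_map_def topspace_spa using maps op by blast
qed

end

lemma (in cring) adic_pair_generic:
  assumes "w \<in> carrier R"
  shows "adic_pair R (generic_ring R w) (generic_map R w) w"
proof -
  interpret M: mult_subset R "powers R w" by (rule mult_subset_powers[OF assms])
  have "w \<in> powers R w"
    unfolding powers_def using assms by (auto intro!: exI[of _ "1::nat"])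
  then show ?thesis
    unfolding adic_pair_def adic_pair_axioms_def generic_ring_def generic_map_def
    using is_cring M.cring_localization M.loc_map_hom M.loc_map_unit assms by blast
qed

theorem lemmaA7:
  fixes V :: "'o ring" and v :: "'o \<Rightarrow> real" and \<pi> :: 'o
    and R :: "'r ring" and \<phi> :: "'o \<Rightarrow> 'r"
  assumes "complete_rank_one_valuation_ring V v"
    and "pseudo_uniformizer V v \<pi>"
    and "admissible_algebra V v \<pi> R \<phi>"
    and "normal_formal_spectrum R (\<phi> \<pi>)"
    and "noetherian_ring (reduced_special_fiber_ring R (\<phi> \<pi>))"
  shows "anticontinuous_map (adic_generic_fiber R (\<phi> \<pi>))
           (zariski_space (special_fiber_ring R (\<phi> \<pi>))) (sp_max R (\<phi> \<pi>))"
proof -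
  interpret cring R using assms(3) by (simp add: admissible_algebra_def)
  have "\<phi> \<pi> \<in> carrier R"
    using assms(2,3) by (auto simp: pseudo_uniformizer_def admissible_algebra_def intro: ring_hom_closed)
  then interpret adic_pair R "generic_ring R (\<phi> \<pi>)" "generic_map R (\<phi> \<pi>)" "\<phi> \<pi>"
    by (rule adic_pair_generic)
  have "adic_generic_fiber R (\<phi> \<pi>) = spa"
    unfolding spa_def adic_generic_fiber_def generic_topology_def ring_topology_def basic_nhd_def ..
  moreover from this have "sp_max R (\<phi> \<pi>) = (\<lambda>x. special_point (maximal_generalization spa x))"
    unfolding sp_max_def sp_def special_point_def by presburger
  ultimately show ?thesis
    using anticontinuous_max_specialization[OF assms(5)] by presburger
qed

end
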